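(* Let $a,b,c,d\in\mathbb{Z}$, let $f(z)=z^5+az^3+bz^2+cz+d\in\mathbb{Z}[z]$, and let $\mathcal{E}_f\subset\mathbb{A}^3$ be the surface $x^2-y^3-f(z)=0$. Then: (1) If $f$ has a multiple root over $\mathbb{C}$, then there exists a rational change of base $z=\psi(t)$, $\psi\in\mathbb{Q}(t)$, such that the elliptic surface $\mathcal{E}_{f\circ\psi}: x^2=y^3+f(\psi(t))$ (viewed as an elliptic curve over $\mathbb{Q}(t)$) has a non-torsion section; and in this case the set of rational points on $\mathcal{E}_f$ is Zariski dense. (2) If $f$ has no multiple roots and the elliptic curve $E_{a,b}: Y^2=X^3+135(2a-15)X-1350(5a+2b-26)$ has infinitely many rational points, then the set of rational points on $\mathcal{E}_f$ is Zariski dense.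
   Context: $\mathcal{E}_f$ is regarded as an elliptic surface over the $z$-line, the fiber over $z$ being the curve $x^2=y^3+f(z)$. A section of $\mathcal{E}_{f\circ\psi}$ is a point $(x,y)\in\mathbb{Q}(t)^2$ with $x^2=y^3+f(\psi(t))$; it is non-torsion if it has infinite order in the group of $\mathbb{Q}(t)$-points of this elliptic curve. Zariski density refers to the Zariski topology on the surface. *)

theory Defs
  imports
    "HOL-Computational_Algebra.Computational_Algebra"
    "HOL-Analysis.Abstract_Topology"
begin

text \<open>
  Polynomial functions on affine 3-space over \<open>\<complex>\<close>: trivariate polynomials are iterated univariate ones,
  the outermost variable being \<open>x\<close>, the innermost \<open>z\<close>.
\<close>

definition eval3 :: "complex poly poly poly \<Rightarrow> complex \<times> complex \<times> complex \<Rightarrow> complex" where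
  "eval3 p = (\<lambda>(x, y, z). poly (poly (poly p [:[:x:]:]) [:y:]) z)"

definition zariski_closed :: "(complex \<times> complex \<times> complex) set \<Rightarrow> bool" where
  "zariski_closed Z \<longleftrightarrow> (\<exists>P. Z = {v. \<forall>p\<in>P. eval3 p v = 0})"

definition zariski :: "(complex \<times> complex \<times> complex) topology" where
  "zariski = topology (\<lambda>U. zariski_closed (- U))"

lemma eval3_mult: "eval3 (p * q) v = eval3 p v * eval3 q v"
  by (cases v) (simp add: eval3_def)

lemma zariski_closed_Un:
  assumes "zariski_closed Z" "zariski_closed W"
  shows "zariski_closed (Z \<union> W)"
proof -
  from assms obtain P Q where P: "Z = {v. \<forall>p\<in>P. eval3 p v = 0}"
    and Q: "W = {v. \<forall>q\<in>Q. eval3 q v = 0}"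
    unfolding zariski_closed_def by blast
  have "Z \<union> W = {v. \<forall>r \<in> {p * q |p q. p \<in> P \<and> q \<in> Q}. eval3 r v = 0}"
  proof (intro set_eqI iffI)
    fix v assume v: "v \<in> {v. \<forall>r \<in> {p * q |p q. p \<in> P \<and> q \<in> Q}. eval3 r v = 0}"
    show "v \<in> Z \<union> W"
    proof (rule ccontr)
      assume "v \<notin> Z \<union> W"
      then obtain p q where pq: "p \<in> P" "q \<in> Q" "eval3 p v \<noteq> 0" "eval3 q v \<noteq> 0"
        unfolding P Q by blast
      then have "eval3 (p * q) v = 0"
        using v by blast
      with pq show False
        by (simp add: eval3_mult)
    qed
  qed (auto simp: P Q eval3_mult)
  then show ?thesis
    unfolding zariski_closed_def by blast
qed

lemma zariski_closed_Inter:
  assumes "\<And>Z. Z \<in> \<Z> \<Longrightarrow> zariski_closed Z"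
  shows "zariski_closed (\<Inter>\<Z>)"
proof -
  from assms have "\<forall>Z\<in>\<Z>. \<exists>P. Z = {v. \<forall>p\<in>P. eval3 p v = 0}"
    unfolding zariski_closed_def by blast
  then obtain P where P: "\<forall>Z\<in>\<Z>. Z = {v. \<forall>p\<in>P Z. eval3 p v = 0}"
    by (rule bchoice[THEN exE])
  have "\<Inter>\<Z> = {v. \<forall>p \<in> (\<Union>Z\<in>\<Z>. P Z). eval3 p v = 0}"
  proof (intro set_eqI iffI)
    fix v assume "v \<in> \<Inter>\<Z>"
    then show "v \<in> {v. \<forall>p \<in> (\<Union>Z\<in>\<Z>. P Z). eval3 p v = 0}"
      using P by fastforce
  next
    fix v assume v: "v \<in> {v. \<forall>p \<in> (\<Union>Z\<in>\<Z>. P Z). eval3 p v = 0}"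
    show "v \<in> \<Inter>\<Z>"
    proof
      fix Z assume Z: "Z \<in> \<Z>"
      then have "v \<in> {v. \<forall>p\<in>P Z. eval3 p v = 0}"
        using v by blast
      with P Z show "v \<in> Z"
        by (metis (lifting))
    qed
  qed
  then show ?thesis
    unfolding zariski_closed_def by blast
qed

lemma istopology_zariski: "istopology (\<lambda>U. zariski_closed (- U))"
  unfolding istopology_def
proof (intro conjI allI impI)
  fix \<U> :: "(complex \<times> complex \<times> complex) set set"
  assume "\<forall>U\<in>\<U>. zariski_closed (- U)"
  then have "zariski_closed (\<Inter>(uminus ` \<U>))"
    by (intro zariski_closed_Inter) auto
  moreover have "- \<Union>\<U> = \<Inter>(uminus ` \<U>)"
    by auto
  ultimately show "zariski_closed (- \<Union>\<U>)"
    by simp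
qed (simp add: zariski_closed_Un)

lemma openin_zariski: "openin zariski U \<longleftrightarrow> zariski_closed (- U)"
  unfolding zariski_def by (simp add: topology_inverse'[OF istopology_zariski])

lemma topspace_zariski: "topspace zariski = UNIV"
proof -
  have "zariski_closed {}"
    unfolding zariski_closed_def by (rule exI[of _ "{1}"]) (simp add: eval3_def)
  then have "openin zariski UNIV"
    by (simp add: openin_zariski)
  then show ?thesis
    using openin_subset by blast
qed

definition zariski_dense_in ::
  "(complex \<times> complex \<times> complex) set \<Rightarrow> (complex \<times> complex \<times> complex) set \<Rightarrow> bool" where
  "zariski_dense_in A S \<longleftrightarrow> subtopology zariski S closure_of A = S"

definition surface :: "int poly \<Rightarrow> (complex \<times> complex \<times> complex) set" where
  "surface f = {(x, y, z). x ^ 2 - y ^ 3 - poly (map_poly of_int f) z = 0}"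

definition rational_points :: "(complex \<times> complex \<times> complex) set \<Rightarrow> (complex \<times> complex \<times> complex) set" where
  "rational_points S = S \<inter> \<rat> \<times> \<rat> \<times> \<rat>"

definition has_multiple_root :: "int poly \<Rightarrow> bool" where
  "has_multiple_root f \<longleftrightarrow> (\<exists>\<alpha>::complex. order \<alpha> (map_poly of_int f) \<ge> 2)"

text \<open>
  Short Weierstrass curves \<open>Y\<^sup>2 = X\<^sup>3 + A X + B\<close> over a field of characteristic 0, with their
  point at infinity \<open>\<O>\<close> and the chord--tangent addition.
\<close>

datatype 'a ell_point = Infinity | Affine 'a 'a

definition elliptic :: "'a::field_char_0 \<Rightarrow> 'a \<Rightarrow> bool" where
  "elliptic A B \<longleftrightarrow> 4 * A ^ 3 + 27 * B ^ 2 \<noteq> 0"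

fun on_curve :: "'a::field_char_0 \<Rightarrow> 'a \<Rightarrow> 'a ell_point \<Rightarrow> bool" where
  "on_curve A B Infinity \<longleftrightarrow> True"
| "on_curve A B (Affine X Y) \<longleftrightarrow> Y ^ 2 = X ^ 3 + A * X + B"

text \<open>
  For two points of the curve with the same \<open>X\<close>, either \<open>Y\<^sub>1 = - Y\<^sub>2\<close> or the points are equal
  with \<open>Y\<^sub>1 \<noteq> 0\<close>; hence the tangent slope needs no further case distinction. The coefficient
  \<open>B\<close> does not enter the addition formulas.
\<close>

fun ell_add :: "'a::field_char_0 \<Rightarrow> 'a ell_point \<Rightarrow> 'a ell_point \<Rightarrow> 'a ell_point" where
  "ell_add A Infinity Q = Q"
| "ell_add A P Infinity = P"
| "ell_add A (Affine X1 Y1) (Affine X2 Y2) =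
    (if X1 = X2 \<and> Y1 = - Y2 then Infinity
     else let l = (if X1 = X2 then (3 * X1 ^ 2 + A) / (2 * Y1) else (Y2 - Y1) / (X2 - X1));
              X3 = l ^ 2 - X1 - X2
          in Affine X3 (l * (X1 - X3) - Y1))"

primrec ell_mult :: "'a::field_char_0 \<Rightarrow> nat \<Rightarrow> 'a ell_point \<Rightarrow> 'a ell_point" where
  "ell_mult A 0 P = Infinity"
| "ell_mult A (Suc n) P = ell_add A P (ell_mult A n P)"

definition non_torsion :: "'a::field_char_0 \<Rightarrow> 'a ell_point \<Rightarrow> bool" where
  "non_torsion A P \<longleftrightarrow> (\<forall>n>0. ell_mult A n P \<noteq> Infinity)"

text \<open>The field \<open>\<rat>(t)\<close>, and \<open>f(\<psi>(t)) \<in> \<rat>(t)\<close> for \<open>f \<in> \<int>[z]\<close>.\<close>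

type_synonym ratfun = "rat poly fract"

definition nonconstant :: "ratfun \<Rightarrow> bool" where
  "nonconstant \<psi> \<longleftrightarrow> (\<forall>q. \<psi> \<noteq> Fract [:q:] 1)"

definition base_change :: "int poly \<Rightarrow> ratfun \<Rightarrow> ratfun" where
  "base_change f \<psi> = poly (map_poly of_int f) \<psi>"

text \<open>
  In \<open>x\<^sup>2 = y\<^sup>3 + f(\<psi>(t))\<close> the Weierstrass coordinates are \<open>X = y\<close> and \<open>Y = x\<close>.
\<close>

definition has_non_torsion_section :: "int poly \<Rightarrow> ratfun \<Rightarrow> bool" where
  "has_non_torsion_section f \<psi> \<longleftrightarrow>
    (\<exists>x y. x ^ 2 = y ^ 3 + base_change f \<psi> \<and> non_torsion 0 (Affine y x))"

definition E_points :: "int \<Rightarrow> int \<Rightarrow> rat ell_point set" where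
  "E_points a b = {P. on_curve (of_int (135 * (2 * a - 15))) (of_int (- 1350 * (5 * a + 2 * b - 26))) P}"

end

(*
  Non-torsion sections come from specialisation at a point t of the base. If x^2 = y^3 + k over Q(t)
  and k / y^3 vanishes at t, the curve degenerates there to the cusp x^2 = y^3, whose smooth part is
  the additive group: the n-th multiple of (y, x) behaves like (y / n^2, x / n^3), so it is never the
  point at infinity. If f has a rational double root r, look for y quadratic and x cubic in z such
  that (z - r)^2 divides x^2 - y^3 - f(z) and the quotient is linear; its root is the base change.
  Otherwise f = (z - r) h^2 with h quadratic, and y = h, x = h x' reduces the equation to a conic
  with a rational point. If f has no multiple root, the analogous polynomials x and y with
  x^2 - y^3 - f(z) linear are parametrised by the curve E_{a,b}.

  In all cases infinitely many fibres carry a rational point P that is not one of the obvious torsion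
  points, and such a fibre has infinitely many rational points: in terms of c = y^3 / k, duplication
  and triplication act by rational maps that push the 2-adic valuation of c to infinity in absolute
  value. Finally, a polynomial vanishing at all rational points of infinitely many such fibres
  vanishes on the surface: modulo x^2 - y^3 - f it is p0 + p1 x, its norm p0^2 - p1^2 (y^3 + f)
  vanishes identically, and the degree in y then forces p0 = p1 = 0.
*)

theory Submission imports Defs begin

section \<open>Density from infinitely many infinite fibres\<close>

text \<open>A point of \<open>S\<close> outside the closure has an open neighbourhood missing
  \<open>A\<close>. The polynomials cutting out its complement vanish on \<open>A\<close>, hence
  also at the point, a contradiction.\<close>

lemma zariski_dense_inI:
  assumes "A \<subseteq> S" "\<And>p. (\<And>v. v \<in> A \<Longrightarrow> eval3 p v = 0) \<Longrightarrow> (\<And>v. v \<in> S \<Longrightarrow> eval3 p v = 0)"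
  shows "zariski_dense_in A S"
  unfolding zariski_dense_in_def
proof
  show "subtopology zariski S closure_of A \<subseteq> S"
    using closure_of_subset_topspace[of "subtopology zariski S" A] by auto
  show "S \<subseteq> subtopology zariski S closure_of A"
  proof
    fix v assume v: "v \<in> S"
    have "\<exists>w. w \<in> A \<and> w \<in> U \<inter> S" if U: "v \<in> U" "openin zariski U" for U
    proof (rule ccontr)
      assume none: "\<not> (\<exists>w. w \<in> A \<and> w \<in> U \<inter> S)"
      obtain P where P: "- U = {v. \<forall>p\<in>P. eval3 p v = 0}"
        using U(2) unfolding openin_zariski zariski_closed_def by blast
      have "eval3 p v = 0" if "p \<in> P" for p
      proof (rule assms(2)[OF _ v])
        fix w assume "w \<in> A"
        then have "w \<in> - U"
          using none assms(1) by blast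
        then show "eval3 p w = 0"
          using that P by blast
      qed
      then show False
        using U(1) P by blast
    qed
    then show "v \<in> subtopology zariski S closure_of A"
      using v by (auto simp: in_closure_of openin_subtopology topspace_zariski)
  qed
qed

section \<open>Polynomial identities from infinitely many fibres\<close>

lemma poly_poly_const: "poly (poly N [:y:]) z = poly (map_poly (\<lambda>c. poly c z) N) y"
  for y z :: "'a::comm_ring_1"
  by (induction N) (simp_all add: map_poly_pCons algebra_simps)

text \<open>For \<open>z\<close> in \<open>Z\<close> the specialised polynomial in \<open>y\<close>
  has infinitely many roots, so its coefficients vanish; each coefficient of \<open>N\<close> then
  has infinitely many roots itself.\<close>

lemma bivariate_eq_0:
  fixes N :: "'a::idom poly poly"
  assumes "infinite Z" "\<And>z. z \<in> Z \<Longrightarrow> infinite {y. poly (poly N [:y:]) z = 0}"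
  shows "N = 0"
proof (rule poly_eqI)
  fix i
  have "poly (coeff N i) z = 0" if "z \<in> Z" for z
  proof -
    have "map_poly (\<lambda>c. poly c z) N = 0"
      using assms(2)[OF that] poly_roots_finite unfolding poly_poly_const by blast
    then show ?thesis
      by (metis coeff_0 coeff_map_poly poly_0)
  qed
  then have "Z \<subseteq> {z. poly (coeff N i) z = 0}"
    by blast
  then show "coeff N i = coeff 0 i"
    using assms(1) poly_roots_finite[of "coeff N i"] infinite_super by auto
qed

text \<open>If \<open>q\<close> were non-zero, degrees would give
  \<open>2 deg p = 2 deg q + deg g\<close>, against parity. This shows that a norm
  \<open>p^2 - q^2 g\<close> vanishes only trivially, on the surface and on the auxiliary curve
  alike.\<close>

lemma square_times_odd_degree:
  fixes p q g :: "'a::idom poly"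
  assumes "p ^ 2 = q ^ 2 * g" "odd (degree g)"
  shows "p = 0" "q = 0"
proof -
  show "q = 0"
  proof (rule ccontr)
    assume q: "q \<noteq> 0"
    have g: "g \<noteq> 0"
      using assms(2) by auto
    then have "p \<noteq> 0"
      using assms(1) q by auto
    then have "2 * degree p = 2 * degree q + degree g"
      using arg_cong[OF assms(1), of degree] q g by (simp add: degree_mult_eq degree_power_eq)
    then show False
      using assms(2) by presburger
  qed
  then show "p = 0"
    using assms(1) by simp
qed

text \<open>Reduction modulo \<open>x^2 - y^3 - f(z)\<close> by Horner's scheme:
  \<open>x (q0 + q1 x)\<close> becomes \<open>q1 (y^3 + f) + q0 x\<close>.\<close>

lemma eval3_on_surface:
  "\<exists>p0 p1. \<forall>x y z. (x, y, z) \<in> surface f \<longrightarrow>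
     eval3 p (x, y, z) = poly (poly p0 [:y:]) z + poly (poly p1 [:y:]) z * x"
proof (induction p)
  case 0
  show ?case
    by (intro exI[of _ 0]) (simp add: eval3_def)
next
  case (pCons c q)
  then obtain q0 q1 where q: "\<And>x y z. (x, y, z) \<in> surface f \<Longrightarrow>
     eval3 q (x, y, z) = poly (poly q0 [:y:]) z + poly (poly q1 [:y:]) z * x"
    by blast
  let ?G = "[:map_poly of_int f, 0, 0, 1:] :: complex poly poly"
  have "eval3 (pCons c q) (x, y, z) = poly (poly (c + q1 * ?G) [:y:]) z + poly (poly q0 [:y:]) z * x"
    if "(x, y, z) \<in> surface f" for x y z
  proof -
    have "x * x = y * (y * y) + poly (map_poly of_int f) z"
      using that by (simp add: surface_def power2_eq_square power3_eq_cube algebra_simps)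
    then have "poly (poly q1 [:y:]) z * (x * x) =
        poly (poly q1 [:y:]) z * (y * (y * y) + poly (map_poly of_int f) z)"
      by simp
    moreover have "eval3 (pCons c q) (x, y, z) = poly (poly c [:y:]) z + x * eval3 q (x, y, z)"
      by (simp add: eval3_def)
    ultimately show ?thesis
      using q[OF that] by (simp add: algebra_simps)
  qed
  then show ?case
    by blast
qed

lemma poly_of_int_of_rat:
  "poly (map_poly of_int f) (of_rat z :: 'a::field_char_0) = of_rat (poly (map_poly of_int f) z)"
  by (induction f) (simp_all add: map_poly_pCons of_rat_add of_rat_mult)

lemma infinite_fibres_dense:
  assumes "infinite {z::rat. infinite {y::rat. \<exists>x. x ^ 2 = y ^ 3 + poly (map_poly of_int f) z}}"
    (is "infinite ?Z")
  shows "zariski_dense_in (rational_points (surface f)) (surface f)"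
proof (rule zariski_dense_inI)
  show "rational_points (surface f) \<subseteq> surface f"
    by (auto simp: rational_points_def)
next
  fix p v
  assume p: "\<And>v. v \<in> rational_points (surface f) \<Longrightarrow> eval3 p v = 0" and v: "v \<in> surface f"
  obtain p0 p1 where p01: "\<And>x y z. (x, y, z) \<in> surface f \<Longrightarrow>
     eval3 p (x, y, z) = poly (poly p0 [:y:]) z + poly (poly p1 [:y:]) z * x"
    using eval3_on_surface[of f p] by blast
  define G where "G = ([:map_poly of_int f, 0, 0, 1:] :: complex poly poly)"
  \<comment> \<open>The norm is free of \<open>x\<close>. The outer variable is \<open>y\<close>,
    and \<open>G = y^3 + f\<close> has odd degree in it.\<close>
  have "p0 ^ 2 - p1 ^ 2 * G = 0"
  proof (rule bivariate_eq_0[of "of_rat ` ?Z"])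
    show "infinite ((of_rat :: rat \<Rightarrow> complex) ` ?Z)"
      using assms by (simp add: finite_image_iff inj_on_def)
    fix z' :: complex assume "z' \<in> of_rat ` ?Z"
    then obtain z where z: "z \<in> ?Z" "z' = of_rat z"
      by blast
    let ?Y = "{y. \<exists>x. x ^ 2 = y ^ 3 + poly (map_poly of_int f) z}"
    have "poly (poly (p0 ^ 2 - p1 ^ 2 * G) [:of_rat y:]) z' = 0" if y: "y \<in> ?Y" for y
    proof -
      obtain x where x: "x ^ 2 = y ^ 3 + poly (map_poly of_int f) z"
        using y by blast
      let ?x = "of_rat x :: complex" and ?y = "of_rat y :: complex"
      have x2: "?x ^ 2 = ?y ^ 3 + poly (map_poly of_int f) z'"
        using arg_cong[OF x, of "of_rat :: rat \<Rightarrow> complex"]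
        by (simp add: z poly_of_int_of_rat of_rat_add of_rat_power)
      then have s: "(?x, ?y, z') \<in> surface f"
        by (simp add: surface_def)
      then have "(?x, ?y, z') \<in> rational_points (surface f)"
        by (simp add: rational_points_def z)
      then have "poly (poly p0 [:?y:]) z' = - (poly (poly p1 [:?y:]) z' * ?x)"
        using p01[OF s] p by (simp add: add_eq_0_iff2)
      then have "poly (poly p0 [:?y:]) z' ^ 2 = poly (poly p1 [:?y:]) z' ^ 2 * ?x ^ 2"
        by (simp add: power_mult_distrib)
      then show ?thesis
        by (simp add: x2 G_def algebra_simps power3_eq_cube)
    qed
    then have "of_rat ` ?Y \<subseteq> {y. poly (poly (p0 ^ 2 - p1 ^ 2 * G) [:y:]) z' = 0}"
      by blast
    moreover have "infinite ((of_rat :: rat \<Rightarrow> complex) ` ?Y)"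
      using z(1) by (simp add: finite_image_iff inj_on_def)
    ultimately show "infinite {y. poly (poly (p0 ^ 2 - p1 ^ 2 * G) [:y:]) z' = 0}"
      by (rule infinite_super)
  qed
  then have "p0 ^ 2 = p1 ^ 2 * G"
    by simp
  then have "p0 = 0" "p1 = 0"
    by (rule square_times_odd_degree; simp add: G_def)+
  then show "eval3 p v = 0"
    using p01 v by (cases v) simp
qed

section \<open>Infinitely many points on a fibre\<close>

text \<open>The 2-adic valuation, with the default \<open>val2 0 = 0\<close> in place of infinity;
  hence the non-vanishing hypotheses below.\<close>

definition val2 :: "rat \<Rightarrow> int" where
  "val2 r = int (multiplicity 2 (fst (quotient_of r))) - int (multiplicity 2 (snd (quotient_of r)))"

text \<open>Cross-multiplication and additivity of the multiplicity of a prime pass from the reduced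
  fraction to an arbitrary one.\<close>

lemma val2_fraction:
  assumes "a \<noteq> 0" "b \<noteq> 0"
  shows "val2 (of_int a / of_int b) = int (multiplicity 2 a) - int (multiplicity 2 b)"
proof -
  obtain p q where pq: "quotient_of (of_int a / of_int b) = (p, q)"
    by (cases "quotient_of (of_int a / of_int b)")
  have q: "q > 0"
    using quotient_of_denom_pos[OF pq] .
  have eq: "(of_int a / of_int b :: rat) = of_int p / of_int q"
    using quotient_of_div[OF pq] .
  then have "(of_int (a * q) :: rat) = of_int (p * b)"
    using q assms by (simp add: field_simps)
  then have aq: "a * q = p * b"
    by (simp only: of_int_eq_iff)
  moreover have "p \<noteq> 0"
    using aq q assms by auto
  moreover have "prime_elem (2::int)"
    by auto
  ultimately have "multiplicity 2 a + multiplicity 2 q = multiplicity 2 p + multiplicity 2 b"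
    using q assms by (metis less_irrefl prime_elem_multiplicity_mult_distrib)
  then show ?thesis
    by (simp add: val2_def pq)
qed

lemma rat_fraction:
  fixes r :: rat
  assumes "r \<noteq> 0"
  obtains a b where "a \<noteq> 0" "b \<noteq> 0" "r = of_int a / of_int b"
proof -
  obtain p q where pq: "quotient_of r = (p, q)"
    by (cases "quotient_of r")
  show ?thesis
    using that[of p q] quotient_of_denom_pos[OF pq] quotient_of_div[OF pq] assms by auto
qed

lemma val2_mult:
  assumes "r \<noteq> 0" "s \<noteq> 0"
  shows "val2 (r * s) = val2 r + val2 s"
proof -
  obtain a b c d where *: "a \<noteq> 0" "b \<noteq> 0" "r = of_int a / of_int b"
      "c \<noteq> 0" "d \<noteq> 0" "s = of_int c / of_int d"
    using assms rat_fraction by metis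
  have "r * s = of_int (a * c) / of_int (b * d)"
    by (simp add: *)
  moreover have "multiplicity 2 (a * c) = multiplicity 2 a + multiplicity 2 c"
      "multiplicity 2 (b * d) = multiplicity 2 b + multiplicity 2 d"
    using * by (auto intro!: prime_elem_multiplicity_mult_distrib)
  ultimately show ?thesis
    using val2_fraction[of "a * c" "b * d"] val2_fraction[of a b] val2_fraction[of c d] * by simp
qed

lemma val2_power: "r \<noteq> 0 \<Longrightarrow> val2 (r ^ n) = int n * val2 r"
proof (induction n)
  case 0
  then show ?case
    using val2_fraction[of 1 1] by simp
next
  case (Suc n)
  then show ?case
    by (simp add: val2_mult algebra_simps)
qed

lemma val2_divide:
  assumes "r \<noteq> 0" "s \<noteq> 0"
  shows "val2 (r / s) = val2 r - val2 s"
  using val2_mult[of "r / s" s] assms by simp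

lemma val2_2: "val2 2 = 1"
  using val2_fraction[of 2 1] by simp

lemma val2_minus: "val2 (- r) = val2 r"
proof (cases "r = 0")
  case False
  moreover have "val2 (- 1) = 0"
    using val2_fraction[of "- 1" 1] by simp
  ultimately show ?thesis
    using val2_mult[of "- 1" r] by simp
qed simp

lemma val2_odd: "odd a \<Longrightarrow> val2 (of_int a) = 0"
  using val2_fraction[of a 1] by (cases "a = 0") (auto simp: not_dvd_imp_multiplicity_0)

text \<open>The strict ultrametric law: a unique term of least valuation determines the sum. The sum
  is non-zero because \<open>r = - s\<close> would force equal valuations.\<close>

lemma val2_add:
  assumes "r \<noteq> 0" "s \<noteq> 0" "val2 r < val2 s"
  shows "r + s \<noteq> 0" "val2 (r + s) = val2 r"
proof -
  obtain a b c d where *: "a \<noteq> 0" "b \<noteq> 0" "r = of_int a / of_int b"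
      "c \<noteq> 0" "d \<noteq> 0" "s = of_int c / of_int d"
    using assms rat_fraction by metis
  have m: "multiplicity 2 (a * d) = multiplicity 2 a + multiplicity 2 d"
      "multiplicity 2 (c * b) = multiplicity 2 c + multiplicity 2 b"
      "multiplicity 2 (b * d) = multiplicity 2 b + multiplicity 2 d"
    using * by (auto intro!: prime_elem_multiplicity_mult_distrib)
  have rs: "r + s = of_int (a * d + c * b) / of_int (b * d)"
    using * by (simp add: field_simps)
  have lt: "multiplicity 2 (a * d) < multiplicity 2 (c * b)"
    using assms(3) * m by (simp add: val2_fraction)
  show "r + s \<noteq> 0"
    using assms(3) val2_minus[of s] by (auto simp: add_eq_0_iff)
  then have "a * d + c * b \<noteq> 0"
    using rs by (metis div_0 of_int_0)
  moreover have "multiplicity 2 (a * d + c * b) = multiplicity 2 (a * d)"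
    using lt * by (intro multiplicity_sum_lt) auto
  ultimately show "val2 (r + s) = val2 r"
    using val2_fraction[of "a * d + c * b" "b * d"] val2_fraction[of a b] rs * m by simp
qed

lemma val2_unit:
  assumes "r \<noteq> 0" "val2 r = 0"
  obtains a b where "odd a" "odd b" "r = of_int a / of_int b"
proof -
  obtain a b where *: "a \<noteq> 0" "b \<noteq> 0" "r = of_int a / of_int b"
    using assms rat_fraction by metis
  obtain a' where a': "a = 2 ^ multiplicity 2 a * a'" "\<not> 2 dvd a'"
    using multiplicity_decompose'[of a 2] * by auto
  obtain b' where b': "b = 2 ^ multiplicity 2 b * b'" "\<not> 2 dvd b'"
    using multiplicity_decompose'[of b 2] * by auto
  have "multiplicity 2 a = multiplicity 2 b"
    using assms(2) * by (simp add: val2_fraction)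
  then obtain n where "a = 2 ^ n * a'" "b = 2 ^ n * b'"
    using a'(1) b'(1) by metis
  then have "r = of_int a' / of_int b'"
    using *(3) by simp
  then show ?thesis
    using that a' b' by auto
qed

text \<open>Over an odd common denominator the numerator is a sum of two odd integers.\<close>

lemma val2_add_units:
  assumes "r \<noteq> 0" "s \<noteq> 0" "val2 r = 0" "val2 s = 0" "r + s \<noteq> 0"
  shows "val2 (r + s) \<ge> 1"
proof -
  obtain a b c d where *: "odd a" "odd b" "r = of_int a / of_int b"
      "odd c" "odd d" "s = of_int c / of_int d"
    using assms val2_unit by metis
  then have nz: "b \<noteq> 0" "d \<noteq> 0" by auto
  have rs: "r + s = of_int (a * d + c * b) / of_int (b * d)"
    using * nz by (simp add: field_simps)
  then have ne: "a * d + c * b \<noteq> 0"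
    using assms(5) by (metis div_0 of_int_0)
  have "multiplicity 2 (a * d + c * b) \<ge> 1"
    using * ne by (intro multiplicity_geI) auto
  moreover have "multiplicity 2 (b * d) = 0"
    using * by (intro not_dvd_imp_multiplicity_0) auto
  ultimately show ?thesis
    using val2_fraction[OF ne, of "b * d"] nz rs by simp
qed

text \<open>
  In terms of \<open>c = y\<^sup>3 / k\<close> on \<open>x\<^sup>2 = y\<^sup>3 + k\<close>, the two rational maps below describe \<open>P \<mapsto> 2P\<close>
  and \<open>P \<mapsto> 3P\<close>; proving them closed on rational points directly avoids the group law.
\<close>

definition cubes_over :: "rat \<Rightarrow> rat set" where
  "cubes_over k = {c. \<exists>x y. x ^ 2 = y ^ 3 + k \<and> y ^ 3 = c * k}"

lemma cubes_over_double:
  assumes "c \<in> cubes_over k" "c \<noteq> - 1"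
  shows "c * (c - 8) ^ 3 / (64 * (c + 1) ^ 3) \<in> cubes_over k"
proof -
  obtain x y where xy: "x ^ 2 = y ^ 3 + k" "y ^ 3 = c * k"
    using assms by (auto simp: cubes_over_def)
  have c: "c + 1 \<noteq> 0"
    using assms(2) by (simp add: add_eq_0_iff)
  \<comment> \<open>The duplication formulas \<open>y (y^3 - 8 k) / (4 x^2)\<close> and
    \<open>(y^6 + 20 k y^3 - 8 k^2) / (8 x^3)\<close>, rewritten with \<open>y^3 = c k\<close> and
    \<open>x^2 = (c + 1) k\<close>.\<close>
  define y' where "y' = y * (c - 8) / (4 * (c + 1))"
  define x' where "x' = x * (c ^ 2 + 20 * c - 8) / (8 * (c + 1) ^ 2)"
  have y': "y' ^ 3 = c * (c - 8) ^ 3 / (64 * (c + 1) ^ 3) * k"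
    unfolding y'_def by (simp add: power_mult_distrib power_divide xy del: distrib_left_numeral)
  have x2: "x ^ 2 = (c + 1) * k"
    using xy by (simp add: algebra_simps)
  have "x' ^ 2 = (c + 1) * k * (c ^ 2 + 20 * c - 8) ^ 2 / (64 * (c + 1) ^ 4)"
    unfolding x'_def by (simp add: power_mult_distrib power_divide x2 flip: power_mult)
  also have "\<dots> = k * (c ^ 2 + 20 * c - 8) ^ 2 / (64 * (c + 1) ^ 3)"
    using c by (simp add: divide_simps power_numeral_reduce)
  also have "(c ^ 2 + 20 * c - 8) ^ 2 = c * (c - 8) ^ 3 + 64 * (c + 1) ^ 3"
    by algebra
  also have "k * (c * (c - 8) ^ 3 + 64 * (c + 1) ^ 3) / (64 * (c + 1) ^ 3) = y' ^ 3 + k"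
    unfolding y' using c by (simp add: field_simps)
  finally show ?thesis
    using y' unfolding cubes_over_def by blast
qed

lemma cubes_over_triple:
  assumes "c \<in> cubes_over k" "c \<noteq> 0" "c \<noteq> - 4"
  shows "(c ^ 3 - 96 * c ^ 2 + 48 * c + 64) ^ 3 / (729 * c ^ 2 * (c + 4) ^ 6) \<in> cubes_over k"
proof -
  obtain x y where xy: "x ^ 2 = y ^ 3 + k" "y ^ 3 = c * k"
    using assms by (auto simp: cubes_over_def)
  have c: "c + 4 \<noteq> 0"
    using assms(3) by (simp add: add_eq_0_iff)
  \<comment> \<open>\<open>\<phi>\<close> and \<open>\<omega>\<close> are the numerators of the
    triplication formulas, freed of powers of \<open>k\<close>. The denominators come from the
    division polynomial \<open>3 y (y^3 + 4 k)\<close>, whose zeros are \<open>c = 0\<close> and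
    \<open>c = - 4\<close>.\<close>
  define \<phi> where "\<phi> = c ^ 3 - 96 * c ^ 2 + 48 * c + 64"
  define \<omega> where "\<omega> = c ^ 4 + 220 * c ^ 3 - 1776 * c ^ 2 - 320 * c - 512"
  define y' where "y' = y * \<phi> / (9 * c * (c + 4) ^ 2)"
  define x' where "x' = x * \<omega> / (27 * c * (c + 4) ^ 3)"
  have "y' ^ 3 = c * k * \<phi> ^ 3 / (729 * c ^ 3 * (c + 4) ^ 6)"
    unfolding y'_def by (simp add: power_mult_distrib power_divide xy flip: power_mult)
  then have y': "y' ^ 3 = \<phi> ^ 3 / (729 * c ^ 2 * (c + 4) ^ 6) * k"
    using assms(2) by (simp add: power3_eq_cube power2_eq_square mult_ac)
  have x2: "x ^ 2 = (c + 1) * k"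
    using xy by (simp add: algebra_simps)
  have "x' ^ 2 = (c + 1) * k * \<omega> ^ 2 / (729 * c ^ 2 * (c + 4) ^ 6)"
    unfolding x'_def by (simp add: power_mult_distrib power_divide x2 flip: power_mult)
  also have "(c + 1) * k * \<omega> ^ 2 = k * (\<phi> ^ 3 + 729 * c ^ 2 * (c + 4) ^ 6)"
    unfolding \<omega>_def \<phi>_def by algebra
  also have "k * (\<phi> ^ 3 + 729 * c ^ 2 * (c + 4) ^ 6) / (729 * c ^ 2 * (c + 4) ^ 6) = y' ^ 3 + k"
    unfolding y' using c assms(2) by (simp add: field_simps)
  finally show ?thesis
    using y' unfolding cubes_over_def \<phi>_def by blast
qed

section \<open>Divergence of the 2-adic valuation under multiplication of points\<close>

lemma val2_power_2: "val2 (2 ^ n) = int n"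
  by (simp add: val2_power val2_2)

text \<open>Doubling sends a valuation \<open>v < 0\<close> to \<open>v - 6\<close> and
  \<open>v > 3\<close> to \<open>v + 3\<close>, which a finite set does not allow. One doubling
  leads from valuation 0, 1 or 3 into these ranges, one tripling from valuation 2. For
  \<open>k \<noteq> 0\<close> the excluded \<open>c\<close> belong to points of order 2
  (\<open>- 1\<close>), 3 (\<open>0\<close> and \<open>- 4\<close>) and 6
  (\<open>8\<close>).\<close>

lemma cubes_over_infinite:
  assumes c: "c \<in> cubes_over k" "c \<noteq> 0" "c \<noteq> - 1" "c \<noteq> 8" "c \<noteq> - 4"
  shows "infinite (cubes_over k)"
proof
  assume fin: "finite (cubes_over k)"
  let ?T = "\<lambda>c::rat. c * (c - 8) ^ 3 / (64 * (c + 1) ^ 3)"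
  have val8: "val2 8 = 3" "val2 (- 8) = 3" and val64: "val2 64 = 6" and val1: "val2 1 = 0"
    using val2_power_2[of 3] val2_power_2[of 6] val2_power_2[of 0] val2_minus[of 8] by auto
  have T: "val2 (?T d) = val2 d + 3 * val2 (d - 8) - 6 - 3 * val2 (d + 1)"
      "?T d \<in> cubes_over k" "?T d \<noteq> 0"
    if "d \<in> cubes_over k" "d \<noteq> 0" "d \<noteq> - 1" "d \<noteq> 8" for d
  proof -
    have "d + 1 \<noteq> 0" "d - 8 \<noteq> 0"
      using that by (auto simp: add_eq_0_iff)
    then show "val2 (?T d) = val2 d + 3 * val2 (d - 8) - 6 - 3 * val2 (d + 1)" "?T d \<noteq> 0"
      using that by (simp_all add: val2_divide val2_mult val2_power val64)
    show "?T d \<in> cubes_over k"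
      by (rule cubes_over_double) (use that in auto)
  qed
  have neg: False if "d \<in> cubes_over k" "d \<noteq> 0" "val2 d < 0" for d
  proof -
    define S where "S = {d \<in> cubes_over k. d \<noteq> 0 \<and> val2 d < 0}"
    have "finite S" "S \<noteq> {}"
      using fin that by (auto simp: S_def)
    then obtain e where e: "e \<in> S" "\<And>e'. e' \<in> S \<Longrightarrow> val2 e \<le> val2 e'"
      by (metis arg_min_if_finite(1) arg_min_least)
    then have e': "e \<in> cubes_over k" "e \<noteq> 0" "val2 e < 0"
      by (auto simp: S_def)
    then have "e \<noteq> - 1" "e \<noteq> 8"
      using val1 val8 val2_minus[of 1] by auto
    note Te = T[OF e'(1,2) this]
    have "val2 (e - 8) = val2 e" "val2 (e + 1) = val2 e"
      using val2_add(2)[of e "- 8"] val2_add(2)[of e 1] e' val8 val1 by auto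
    then have "val2 (?T e) < val2 e"
      using Te(1) by simp
    moreover from this have "?T e \<in> S"
      using Te e' by (simp add: S_def)
    ultimately show False
      using e(2) by fastforce
  qed
  have big: False if "d \<in> cubes_over k" "d \<noteq> 0" "val2 d > 3" for d
  proof -
    define S where "S = {d \<in> cubes_over k. d \<noteq> 0 \<and> val2 d > 3}"
    have "finite S" "S \<noteq> {}"
      using fin that by (auto simp: S_def)
    then obtain e where e: "e \<in> S" "\<And>e'. e' \<in> S \<Longrightarrow> val2 e \<ge> val2 e'"
      using arg_min_if_finite(1)[of S "\<lambda>e. - val2 e"] arg_min_least[of S _ "\<lambda>e. - val2 e"] 
      by (metis neg_le_iff_le)
    then have e': "e \<in> cubes_over k" "e \<noteq> 0" "val2 e > 3"
      by (auto simp: S_def)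
    then have "e \<noteq> - 1" "e \<noteq> 8"
      using val1 val8 val2_minus[of 1] by auto
    note Te = T[OF e'(1,2) this]
    have "val2 (e - 8) = 3" "val2 (e + 1) = 0"
      using val2_add(2)[of "- 8" e] val2_add(2)[of 1 e] e' val8 val1 by (auto simp: add.commute)
    then have "val2 (?T e) > val2 e"
      using Te(1) by simp
    moreover from this have "?T e \<in> S"
      using Te e' by (simp add: S_def)
    ultimately show False
      using e(2) by fastforce
  qed
  note Tc = T[OF c(1-4)]
  have c1: "c + 1 \<noteq> 0" and c8: "c / 8 + - 1 \<noteq> 0"
    using c by (auto simp: add_eq_0_iff)
  have "val2 c < 0 \<or> val2 c = 0 \<or> val2 c = 1 \<or> val2 c = 2 \<or> val2 c = 3 \<or> val2 c > 3"
    by linarith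
  then show False
  proof (elim disjE)
    assume v: "val2 c = 0"
    have "val2 (c - 8) = 0"
      using val2_add(2)[of c "- 8"] v c val8 by simp
    moreover have "val2 (c + 1) \<ge> 1"
      using c v val1 c1 by (intro val2_add_units) auto
    ultimately show False
      using neg[OF Tc(2,3)] Tc(1) v by simp
  next
    assume v: "val2 c = 1"
    have "val2 (c - 8) = 1" "val2 (c + 1) = 0"
      using val2_add(2)[of c "- 8"] val2_add(2)[of 1 c] v c val8 val1 by (auto simp: add.commute)
    then show False
      using neg[OF Tc(2,3)] Tc(1) v by simp
  next
    assume v: "val2 c = 3"
    have "val2 (c + 1) = 0"
      using val2_add(2)[of 1 c] v c val1 by (auto simp: add.commute)
    \<comment> \<open>Both \<open>c / 8\<close> and \<open>- 1\<close> are units, so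
      \<open>c - 8\<close> has valuation at least 4 and the double at least 9.\<close>
    moreover have "val2 (c / 8 + - 1) \<ge> 1"
      using c v val1 val8 c8 val2_minus[of 1] by (intro val2_add_units) (auto simp: val2_divide)
    moreover have "val2 (c - 8) = 3 + val2 (c / 8 + - 1)"
      using val2_mult[of 8 "c / 8 + - 1"] c8 val8 by (simp add: algebra_simps)
    ultimately show False
      using big[OF Tc(2,3)] Tc(1) v by simp
  next
    assume v: "val2 c = 2"
    \<comment> \<open>Doubling fixes valuation 2, as \<open>2 + 3 * 2 - 6 = 2\<close>. Tripling does
      not: its numerator is the cube of \<open>64 \<phi>\<close> with a unit \<open>\<phi>\<close>,
      while \<open>c + 4 = 4 (u + 1)\<close> has valuation at least 3.\<close>
    define u where "u = c / 4"
    have u: "u \<noteq> 0" "val2 u = 0" "u + 1 \<noteq> 0"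
      using c v val2_power_2[of 2] by (auto simp: u_def val2_divide add_eq_0_iff)
    obtain a b where ab: "odd a" "odd b" "u = of_int a / of_int b"
      using val2_unit[OF u(1,2)] .
    define \<phi> where "\<phi> = u ^ 3 - 24 * u ^ 2 + 3 * u + 1"
    define N where "N = a ^ 3 - 24 * a ^ 2 * b + 3 * a * b ^ 2 + b ^ 3"
    have "b \<noteq> 0"
      using ab by auto
    then have \<phi>: "\<phi> = of_int N / of_int (b ^ 3)"
      unfolding \<phi>_def N_def ab(3) by (simp add: field_simps power_numeral_reduce)
    have N: "odd N"
      using ab unfolding N_def by simp
    then have "N \<noteq> 0"
      by auto
    moreover have "val2 \<phi> = 0"
      unfolding \<phi> using N ab \<open>b \<noteq> 0\<close> \<open>N \<noteq> 0\<close> val2_odd[of N] val2_odd[of "b ^ 3"]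
      by (simp add: val2_divide)
    ultimately have \<phi>': "\<phi> \<noteq> 0" "val2 \<phi> = 0"
      using \<phi> \<open>b \<noteq> 0\<close> by auto
    define e where "e = (c ^ 3 - 96 * c ^ 2 + 48 * c + 64) ^ 3 / (729 * c ^ 2 * (c + 4) ^ 6)"
    have "c = 4 * u"
      by (simp add: u_def)
    then have e: "e = (64 * \<phi>) ^ 3 / (729 * (4 * u) ^ 2 * (4 * (u + 1)) ^ 6)"
      unfolding e_def \<phi>_def by (simp add: algebra_simps power_mult_distrib)
    have "val2 4 = 2" "val2 729 = 0"
      using val2_power_2[of 2] val2_odd[of 729] by auto
    then have "val2 (64 * \<phi>) = 6" "val2 (4 * u) = 2" "val2 (4 * (u + 1)) = 2 + val2 (u + 1)"
      using \<phi>' u val64 by (simp_all add: val2_mult del: distrib_left_numeral)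
    moreover have nz: "64 * \<phi> \<noteq> 0" "4 * u \<noteq> 0" "4 * (u + 1) \<noteq> 0"
      using \<phi>' u by (simp_all del: distrib_left_numeral)
    moreover have quot: "A ^ 3 / (729 * C ^ 2 * D ^ 6) \<noteq> 0 \<and>
        val2 (A ^ 3 / (729 * C ^ 2 * D ^ 6)) = 3 * val2 A - 2 * val2 C - 6 * val2 D"
      if "A \<noteq> 0" "C \<noteq> 0" "D \<noteq> 0" for A C D
      using that \<open>val2 729 = 0\<close> by (simp add: val2_divide val2_mult val2_power)
    ultimately have "e \<noteq> 0" "val2 e = 2 - 6 * (2 + val2 (u + 1)) + 12"
      using quot[OF nz] unfolding e[symmetric] by (simp_all del: distrib_left_numeral)
    moreover have "val2 (u + 1) \<ge> 1"
      using u val1 by (intro val2_add_units) auto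
    moreover have "e \<in> cubes_over k"
      unfolding e_def by (rule cubes_over_triple) (use c in auto)
    ultimately show False
      using neg[of e] by simp
  qed (use neg big c in auto)
qed

lemma infinite_fibre:
  fixes x y k :: rat
  assumes "x ^ 2 = y ^ 3 + k" "k \<noteq> 0" "\<forall>c\<in>{0, - 1, 8, - 4}. y ^ 3 \<noteq> c * k"
  shows "infinite {y. \<exists>x. x ^ 2 = y ^ 3 + k}"
proof
  assume fin: "finite {y. \<exists>x. x ^ 2 = y ^ 3 + k}"
  have "cubes_over k \<subseteq> (\<lambda>y. y ^ 3 / k) ` {y. \<exists>x. x ^ 2 = y ^ 3 + k}"
    using assms(2) by (force simp: cubes_over_def image_iff)
  then have "finite (cubes_over k)"
    using fin finite_surj by blast
  moreover have "y ^ 3 / k \<in> cubes_over k"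
    using assms by (auto simp: cubes_over_def)
  moreover have "y ^ 3 / k \<noteq> c" if "c \<in> {0, - 1, 8, - 4}" for c
    using assms that by (auto simp: field_simps)
  ultimately show False
    using cubes_over_infinite by blast
qed

section \<open>Specialisation of rational functions and non-torsion points\<close>

text \<open>A relation, since a pole has no value; any fraction with denominator non-zero at
  \<open>t\<close> may represent \<open>g\<close>, reduced or not.\<close>

definition has_value :: "rat \<Rightarrow> ratfun \<Rightarrow> rat \<Rightarrow> bool" where
  "has_value t g L \<longleftrightarrow> (\<exists>p q. poly q t \<noteq> 0 \<and> g = Fract p q \<and> L = poly p t / poly q t)"

lemma has_value_FractI: "poly q t \<noteq> 0 \<Longrightarrow> L = poly p t / poly q t \<Longrightarrow> has_value t (Fract p q) L"
  unfolding has_value_def by blast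

lemma has_value_unique:
  assumes "has_value t g L" "has_value t g M"
  shows "L = M"
proof -
  obtain p q p' q' where *: "poly q t \<noteq> 0" "g = Fract p q" "L = poly p t / poly q t"
      "poly q' t \<noteq> 0" "g = Fract p' q'" "M = poly p' t / poly q' t"
    using assms unfolding has_value_def by blast
  then have "q \<noteq> 0" "q' \<noteq> 0"
    by auto
  then have "p * q' = p' * q"
    using * by (metis eq_fract(1))
  then have "poly p t * poly q' t = poly p' t * poly q t"
    by (metis poly_mult)
  then show ?thesis
    unfolding *(3,6) using *(1,4) by (simp add: frac_eq_eq)
qed

lemma has_value_const: "has_value t (Fract [:c:] 1) c"
  by (rule has_value_FractI) simp_all

lemma has_value_0: "has_value t 0 0" and has_value_1: "has_value t 1 1"
  unfolding Zero_fract_def One_fract_def by (rule has_value_FractI; simp)+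

lemma has_value_add:
  assumes "has_value t g L" "has_value t h M"
  shows "has_value t (g + h) (L + M)"
proof -
  obtain p q p' q' where *: "poly q t \<noteq> 0" "g = Fract p q" "L = poly p t / poly q t"
      "poly q' t \<noteq> 0" "h = Fract p' q'" "M = poly p' t / poly q' t"
    using assms unfolding has_value_def by blast
  then have "q \<noteq> 0" "q' \<noteq> 0"
    by auto
  then have "g + h = Fract (p * q' + p' * q) (q * q')"
    using * by simp
  then show ?thesis
    using * by (auto intro!: has_value_FractI simp: add_frac_eq)
qed

lemma has_value_mult:
  assumes "has_value t g L" "has_value t h M"
  shows "has_value t (g * h) (L * M)"
proof -
  obtain p q p' q' where *: "poly q t \<noteq> 0" "g = Fract p q" "L = poly p t / poly q t"
      "poly q' t \<noteq> 0" "h = Fract p' q'" "M = poly p' t / poly q' t"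
    using assms unfolding has_value_def by blast
  then show ?thesis
    by (auto intro!: has_value_FractI)
qed

lemma has_value_minus: "has_value t g L \<Longrightarrow> has_value t (- g) (- L)"
  unfolding has_value_def by (metis minus_fract poly_minus minus_divide_left)

lemma has_value_diff: "has_value t g L \<Longrightarrow> has_value t h M \<Longrightarrow> has_value t (g - h) (L - M)"
  using has_value_add[OF _ has_value_minus] by simp

lemma has_value_inverse: "has_value t g L \<Longrightarrow> L \<noteq> 0 \<Longrightarrow> has_value t (inverse g) (inverse L)"
  unfolding has_value_def by (metis inverse_divide inverse_fract div_0)

lemma has_value_divide:
  "has_value t g L \<Longrightarrow> has_value t h M \<Longrightarrow> M \<noteq> 0 \<Longrightarrow> has_value t (g / h) (L / M)"
  by (simp add: has_value_mult has_value_inverse divide_inverse)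

lemma has_value_power: "has_value t g L \<Longrightarrow> has_value t (g ^ n) (L ^ n)"
  by (induction n) (simp_all add: has_value_1 has_value_mult)

lemma has_value_of_nat: "has_value t (of_nat n) (of_nat n)"
  by (induction n) (simp_all add: has_value_0 has_value_1 has_value_add)

lemma has_value_of_int: "has_value t (of_int n) (of_int n)"
  by (cases n) (use has_value_of_nat has_value_minus in \<open>force simp del: of_nat_Suc\<close>)+

lemma has_value_of_rat: "has_value t (of_rat c) c"
proof (cases c)
  case (Fract a b)
  then have "c = of_int a / of_int b" "b \<noteq> 0"
    by (simp_all add: Fract_of_int_quotient)
  then show ?thesis
    by (simp add: of_rat_divide has_value_divide has_value_of_int)
qed

lemma has_value_numeral: "has_value t (numeral n) (numeral n)"
  using has_value_of_nat[of t "numeral n"] by simp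

definition indet :: ratfun where
  "indet = Fract [:0, 1:] 1"

lemma has_value_indet: "has_value t indet t"
  unfolding indet_def by (rule has_value_FractI) simp_all

lemmas has_value_intros =
  has_value_0 has_value_1 has_value_add has_value_mult has_value_minus has_value_diff
  has_value_divide has_value_power has_value_of_int has_value_of_rat has_value_numeral
  has_value_indet

lemma has_value_poly: "has_value t g L \<Longrightarrow> has_value t (base_change f g) (poly (map_poly of_int f) L)"
  unfolding base_change_def
  by (induction f) (simp_all add: has_value_intros map_poly_pCons)

lemma has_value_neq_0: "has_value t g L \<Longrightarrow> L \<noteq> 0 \<Longrightarrow> g \<noteq> 0"
  using has_value_unique has_value_0 by blast

section \<open>Exceptional parameters of a rational function\<close>

lemma finite_no_value: "finite {t. \<nexists>L. has_value t g L}"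
proof (cases g)
  case (Fract p q)
  then have "{t. \<nexists>L. has_value t g L} \<subseteq> {t. poly q t = 0}"
    using has_value_FractI by blast
  then show ?thesis
    using Fract poly_roots_finite finite_subset by blast
qed

lemma finite_no_nonzero_value:
  assumes "g \<noteq> 0"
  shows "finite {t. \<nexists>L. has_value t g L \<and> L \<noteq> 0}"
proof (cases g)
  case (Fract p q)
  then have "p \<noteq> 0"
    using assms fract_collapse(1) by blast
  have "{t. \<nexists>L. has_value t g L \<and> L \<noteq> 0} \<subseteq> {t. poly (p * q) t = 0}"
  proof
    fix t assume "t \<in> {t. \<nexists>L. has_value t g L \<and> L \<noteq> 0}"
    then have "poly p t / poly q t = 0" if "poly q t \<noteq> 0"
      using has_value_FractI[OF that refl] Fract(1) by blast
    then show "t \<in> {t. poly (p * q) t = 0}"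
      by auto
  qed
  moreover have "p * q \<noteq> 0"
    using Fract \<open>p \<noteq> 0\<close> by simp
  ultimately show ?thesis
    using poly_roots_finite finite_subset by blast
qed

text \<open>Chord addition on the cusp \<open>x^2 = y^3\<close> with points
  \<open>(y, x) = (1 / N^2, 1 / N^3)\<close>: parameters 1 and \<open>N\<close> add up to
  \<open>N + 1\<close>.\<close>

lemma chord_value:
  fixes N :: rat
  assumes "N > 1"
  shows "((1 / N ^ 3 - 1) / (1 / N ^ 2 - 1)) ^ 2 - 1 - 1 / N ^ 2 = 1 / (N + 1) ^ 2"
    and "(1 / N ^ 3 - 1) / (1 / N ^ 2 - 1) * (1 - 1 / (N + 1) ^ 2) - 1 = 1 / (N + 1) ^ 3"
proof -
  have N: "N \<noteq> 0" "N + 1 \<noteq> 0" "N - 1 \<noteq> 0"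
    using assms by auto
  have "(1 / N ^ 3 - 1) / (1 / N ^ 2 - 1) = (- (N - 1) * (1 + N + N ^ 2) / N ^ 3) / (- (N - 1) * (N + 1) / N ^ 2)"
    using N by (simp add: field_simps power_numeral_reduce)
  also have "\<dots> = (1 + N + N ^ 2) / (N * (N + 1))"
    using N by (simp add: divide_simps power_numeral_reduce) 
  finally have *: "(1 / N ^ 3 - 1) / (1 / N ^ 2 - 1) = (1 + N + N ^ 2) / (N * (N + 1))" .
  show "((1 / N ^ 3 - 1) / (1 / N ^ 2 - 1)) ^ 2 - 1 - 1 / N ^ 2 = 1 / (N + 1) ^ 2"
    unfolding * using N by (simp add: divide_simps) algebra
  show "(1 / N ^ 3 - 1) / (1 / N ^ 2 - 1) * (1 - 1 / (N + 1) ^ 2) - 1 = 1 / (N + 1) ^ 3"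
    unfolding * using N by (simp add: divide_simps) algebra
qed

text \<open>In coordinates scaled by \<open>y\<close> and \<open>x\<close> the addition formulas
  involve only \<open>\<kappa> = x^2 / y^3\<close>, whose value at \<open>t\<close> is 1. The
  multiples thus specialise to multiples on the cusp, which never reach infinity.\<close>

lemma non_torsion_if_cuspidal:
  fixes x y k :: ratfun
  assumes xy: "x ^ 2 = y ^ 3 + k" "y \<noteq> 0" and k: "has_value t (k / y ^ 3) 0"
  shows "non_torsion 0 (Affine y x)"
proof -
  define \<kappa> where "\<kappa> = 1 + k / y ^ 3"
  have \<kappa>: "has_value t \<kappa> 1"
    unfolding \<kappa>_def using has_value_add[OF has_value_1 k] by simp
  then have "\<kappa> \<noteq> 0"
    by (rule has_value_neq_0) simp
  have x2: "x ^ 2 = y ^ 3 * \<kappa>"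
    using xy by (simp add: \<kappa>_def field_simps)
  then have x: "x \<noteq> 0"
    using xy(2) \<open>\<kappa> \<noteq> 0\<close> by auto
  have one: "ell_mult 0 (Suc 0) (Affine y x) = Affine y x"
    by simp
  \<comment> \<open>The induction starts at 2: the first doubling uses the tangent, every later
    addition a chord.\<close>
  have multiple: "\<exists>\<alpha> \<beta>. ell_mult 0 n (Affine y x) = Affine (y * \<alpha>) (x * \<beta>) \<and>
      has_value t \<alpha> (1 / of_nat n ^ 2) \<and> has_value t \<beta> (1 / of_nat n ^ 3)" if "n \<ge> 2" for n
    using that
  proof (induction n rule: dec_induct)
    case base
    define \<alpha> where "\<alpha> = 9 / (4 * \<kappa>) - 2"
    define \<beta> where "\<beta> = 3 / (2 * \<kappa>) * (1 - \<alpha>) - 1"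
    let ?l = "3 * y ^ 2 / (2 * x)"
    have "?l ^ 2 = 9 * y ^ 4 / (4 * x ^ 2)"
      by (simp add: power_divide power_mult_distrib flip: power_mult)
    also have "\<dots> = y * (9 / (4 * \<kappa>))"
      unfolding x2 using xy(2) by (simp add: power_numeral_reduce)
    finally have X: "?l ^ 2 - y - y = y * \<alpha>"
      by (simp add: \<alpha>_def algebra_simps)
    have "?l = x * (3 * y ^ 2 / (2 * x ^ 2))"
      using x by (simp add: power2_eq_square)
    also have "\<dots> = x * (3 / (2 * \<kappa> * y))"
      unfolding x2 using xy(2) by (simp add: power_numeral_reduce)
    finally have l: "?l = x * (3 / (2 * \<kappa> * y))" .
    have Y: "?l * (y - y * \<alpha>) - x = x * \<beta>"
      unfolding l using xy(2) \<open>\<kappa> \<noteq> 0\<close> by (simp add: \<beta>_def field_simps)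
    have "x \<noteq> - x"
      using x by (simp add: eq_neg_iff_add_eq_0)
    then have "ell_mult 0 (Suc (Suc 0)) (Affine y x) =
        Affine (?l ^ 2 - y - y) (?l * (y - (?l ^ 2 - y - y)) - x)"
      by (simp add: Let_def)
    also have "\<dots> = Affine (y * \<alpha>) (x * \<beta>)"
      unfolding X Y by (rule refl)
    finally have "ell_mult 0 (Suc (Suc 0)) (Affine y x) = Affine (y * \<alpha>) (x * \<beta>)" .
    then have "ell_mult 0 2 (Affine y x) = Affine (y * \<alpha>) (x * \<beta>)"
      by (simp only: numeral_2_eq_2)
    moreover have \<alpha>: "has_value t \<alpha> (9 / (4 * 1) - 2)"
      unfolding \<alpha>_def by (intro has_value_intros \<kappa>) simp
    moreover have "has_value t \<beta> (3 / (2 * 1) * (1 - (9 / (4 * 1) - 2)) - 1)"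
      unfolding \<beta>_def by (intro has_value_intros \<kappa> \<alpha>) simp
    ultimately show ?case
      by (intro exI[of _ \<alpha>] exI[of _ \<beta>]) simp
  next
    case (step n)
    then obtain \<alpha> \<beta> where n: "ell_mult 0 n (Affine y x) = Affine (y * \<alpha>) (x * \<beta>)"
        and \<alpha>: "has_value t \<alpha> (1 / of_nat n ^ 2)" and \<beta>: "has_value t \<beta> (1 / of_nat n ^ 3)"
      by blast
    define N where "N = (of_nat n :: rat)"
    have N: "N > 1"
      using step by (simp add: N_def)
    then have "N ^ 2 \<noteq> 1"
      using one_less_power[OF N pos2] by (metis less_irrefl)
    then have N2: "1 / N ^ 2 \<noteq> 1"
      by simp
    \<comment> \<open>Distinct values at \<open>t\<close> show that the \<open>n\<close>-th multiple
      and the point itself have distinct first coordinates, so the chord formula applies.\<close>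
    then have "\<alpha> \<noteq> 1"
      using has_value_unique[OF \<alpha>] has_value_1 unfolding N_def by metis
    then have y\<alpha>: "y \<noteq> y * \<alpha>" "y * \<alpha> - y \<noteq> 0" "\<alpha> - 1 \<noteq> 0"
      using xy(2) by auto
    define l where "l = (\<beta> - 1) / (\<alpha> - 1)"
    define \<alpha>' where "\<alpha>' = \<kappa> * l ^ 2 - 1 - \<alpha>"
    define \<beta>' where "\<beta>' = l * (1 - \<alpha>') - 1"
    let ?l = "(x * \<beta> - x) / (y * \<alpha> - y)"
    have "x * \<beta> - x = x * (\<beta> - 1)" "y * \<alpha> - y = y * (\<alpha> - 1)"
      by (simp_all add: algebra_simps)
    then have l: "?l = x / y * l"
      by (simp add: l_def)
    have "?l ^ 2 = y * \<kappa> * l ^ 2"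
      unfolding l power_mult_distrib power_divide x2 using xy(2) by (simp add: power_numeral_reduce)
    then have X: "?l ^ 2 - y - y * \<alpha> = y * \<alpha>'"
      by (simp add: \<alpha>'_def algebra_simps)
    have Y: "?l * (y - y * \<alpha>') - x = x * \<beta>'"
      unfolding l using xy(2) by (simp add: \<beta>'_def field_simps)
    have "ell_mult 0 (Suc n) (Affine y x) =
        Affine (?l ^ 2 - y - y * \<alpha>) (?l * (y - (?l ^ 2 - y - y * \<alpha>)) - x)"
      using y\<alpha> by (simp add: n Let_def)
    also have "\<dots> = Affine (y * \<alpha>') (x * \<beta>')"
      unfolding X Y by (rule refl)
    finally have "ell_mult 0 (Suc n) (Affine y x) = Affine (y * \<alpha>') (x * \<beta>')" .
    moreover have l': "has_value t l ((1 / N ^ 3 - 1) / (1 / N ^ 2 - 1))"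
      unfolding l_def N_def
      by (intro has_value_intros \<alpha> \<beta>) (use N2 in \<open>simp add: N_def\<close>)
    moreover have "has_value t \<alpha>' (1 * ((1 / N ^ 3 - 1) / (1 / N ^ 2 - 1)) ^ 2 - 1 - 1 / N ^ 2)"
      unfolding \<alpha>'_def by (intro has_value_intros \<kappa> l') (use \<alpha> in \<open>simp add: N_def\<close>)
    then have \<alpha>': "has_value t \<alpha>' (1 / (N + 1) ^ 2)"
      by (simp only: chord_value(1)[OF N] mult_1)
    moreover have "has_value t \<beta>' ((1 / N ^ 3 - 1) / (1 / N ^ 2 - 1) * (1 - 1 / (N + 1) ^ 2) - 1)"
      unfolding \<beta>'_def by (intro has_value_intros l' \<alpha>')
    then have "has_value t \<beta>' (1 / (N + 1) ^ 3)"
      by (simp only: chord_value(2)[OF N])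
    ultimately show ?case
      by (intro exI[of _ \<alpha>'] exI[of _ \<beta>']) (simp add: N_def add.commute)
  qed
  show ?thesis
    unfolding non_torsion_def
  proof (intro allI impI)
    fix n :: nat assume "n > 0"
    then consider "n = Suc 0" | "n \<ge> 2"
      by linarith
    then show "ell_mult 0 n (Affine y x) \<noteq> Infinity"
      by cases (use one multiple[of n] in auto)
  qed
qed

text \<open>At all but finitely many parameters the section specialises to a rational point avoiding
  the torsion values of \<open>y^3 / k\<close>, and a nonconstant \<open>\<psi>\<close> reaches
  infinitely many fibres.\<close>

lemma section_dense:
  fixes x y \<psi> :: ratfun
  assumes xy: "x ^ 2 = y ^ 3 + base_change f \<psi>" "y \<noteq> 0" "base_change f \<psi> \<noteq> 0"
    and \<psi>: "nonconstant \<psi>" and cusp: "has_value t (base_change f \<psi> / y ^ 3) 0"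
  shows "zariski_dense_in (rational_points (surface f)) (surface f)"
proof (rule infinite_fibres_dense)
  define k where "k = base_change f \<psi>"
  \<comment> \<open>Otherwise \<open>c k / y^3\<close> would be the constant 1, although its value
    at \<open>t\<close> is 0.\<close>
  have "y ^ 3 - of_rat c * k \<noteq> 0" for c
  proof
    assume "y ^ 3 - of_rat c * k = 0"
    then have "of_rat c * k = y ^ 3"
      by simp
    then have "of_rat c * (k / y ^ 3) = 1"
      using xy(2) by (metis divide_self_if power_not_zero times_divide_eq_right)
    moreover have "has_value t (of_rat c * (k / y ^ 3)) (c * 0)"
      using cusp unfolding k_def by (intro has_value_intros)
    ultimately have "has_value t 1 (c * 0)"
      by metis
    from has_value_unique[OF this has_value_1] show False
      by simp
  qed
  note c_neq = this
  define Z where "Z = {z::rat. infinite {y::rat. \<exists>x. x ^ 2 = y ^ 3 + poly (map_poly of_int f) z}}"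
  have "infinite Z"
  proof
    assume fin: "finite Z"
    define bad where "bad g = {t. \<nexists>L. has_value t g L \<and> L \<noteq> 0}" for g
    define C where "C = {0, - 1, 8, - 4 :: rat}"
    have bad: "finite (bad g)" if "g \<noteq> 0" for g
      unfolding bad_def using finite_no_nonzero_value[OF that] .
    have "\<psi> - Fract [:z:] 1 \<noteq> 0" for z
      using \<psi> by (auto simp: nonconstant_def)
    then have "finite (\<Union>z\<in>Z. bad (\<psi> - Fract [:z:] 1))"
      by (intro finite_UN_I[OF fin] bad)
    moreover have "finite (\<Union>c\<in>C. bad (y ^ 3 - of_rat c * k))"
      using bad[OF c_neq] by (intro finite_UN_I) (simp add: C_def)
    moreover have "finite (bad k)"
      using bad xy(3) unfolding k_def by blast
    \<comment> \<open>A parameter outside \<open>B\<close> gives an infinite fibre over the value of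
      \<open>\<psi>\<close>; that value then lies in \<open>Z\<close>, which the last part of
      \<open>B\<close> forbids.\<close>
    moreover define B where "B = {t. \<nexists>L. has_value t x L} \<union> {t. \<nexists>L. has_value t y L} \<union>
        {t. \<nexists>L. has_value t \<psi> L} \<union> bad k \<union> (\<Union>c\<in>C. bad (y ^ 3 - of_rat c * k)) \<union>
        (\<Union>z\<in>Z. bad (\<psi> - Fract [:z:] 1))"
    ultimately have "finite B"
      unfolding B_def by (intro finite_UnI finite_no_value)
    from ex_new_if_finite[OF infinite_UNIV_char_0 this] obtain u where "u \<notin> B" ..
    then have u: "\<exists>L. has_value u x L" "\<exists>L. has_value u y L" "\<exists>L. has_value u \<psi> L" "u \<notin> bad k"
        "\<And>c. c \<in> C \<Longrightarrow> u \<notin> bad (y ^ 3 - of_rat c * k)" "\<And>z. z \<in> Z \<Longrightarrow> u \<notin> bad (\<psi> - Fract [:z:] 1)"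
      unfolding B_def Un_iff UN_iff mem_Collect_eq by blast+
    then obtain x0 y0 z where v: "has_value u x x0" "has_value u y y0" "has_value u \<psi> z"
      by metis
    define k0 where "k0 = poly (map_poly of_int f) z"
    have k0: "has_value u k k0"
      unfolding k_def k0_def by (rule has_value_poly[OF v(3)])
    have nz: "L \<noteq> 0" if "u \<notin> bad g" "has_value u g L" for g L
      using that has_value_unique unfolding bad_def by blast
    have "has_value u (x ^ 2) (x0 ^ 2)" "has_value u (y ^ 3 + k) (y0 ^ 3 + k0)"
      by (intro has_value_intros v k0)+
    then have "x0 ^ 2 = y0 ^ 3 + k0"
      using has_value_unique xy(1)[folded k_def] by metis
    moreover have "k0 \<noteq> 0"
      using nz[OF u(4) k0] .
    moreover have "y0 ^ 3 - c * k0 \<noteq> 0" if "c \<in> C" for c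
    proof (rule nz)
      show "u \<notin> bad (y ^ 3 - of_rat c * k)"
        using u(5) that .
      show "has_value u (y ^ 3 - of_rat c * k) (y0 ^ 3 - c * k0)"
        by (intro has_value_intros v k0)
    qed
    ultimately have "z \<in> Z"
      using infinite_fibre[of x0 y0 k0] by (simp add: C_def k0_def Z_def)
    then have "u \<notin> bad (\<psi> - Fract [:z:] 1)"
      by (rule u(6))
    then have "z - z \<noteq> 0"
      using nz has_value_diff[OF v(3) has_value_const] by blast
    then show False
      by simp
  qed
  then show "infinite {z::rat. infinite {y::rat. \<exists>x. x ^ 2 = y ^ 3 + poly (map_poly of_int f) z}}"
    unfolding Z_def .
qed

lemma section_conclusion:
  fixes x y \<psi> :: ratfun
  assumes "x ^ 2 = y ^ 3 + base_change f \<psi>" "y \<noteq> 0" "base_change f \<psi> \<noteq> 0"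
    and "nonconstant \<psi>" "has_value t (base_change f \<psi> / y ^ 3) 0"
  shows "(\<exists>\<psi>. nonconstant \<psi> \<and> elliptic 0 (base_change f \<psi>) \<and> has_non_torsion_section f \<psi>) \<and>
     zariski_dense_in (rational_points (surface f)) (surface f)"
proof -
  have "non_torsion 0 (Affine y x)"
    using non_torsion_if_cuspidal assms by blast
  then show ?thesis
    using assms section_dense unfolding has_non_torsion_section_def elliptic_def by auto
qed

section \<open>Sections when there is a multiple root\<close>

lemma has_value_eq: "has_value t g M \<Longrightarrow> M = L \<Longrightarrow> has_value t g L"
  by simp

text \<open>The left side minus the right side is \<open>w^2 (A w + B)\<close>: the form of the
  cubic and the quadratic removes the terms of degree 6, 5, 1 and 0, and the condition on
  \<open>f4\<close> that of degree 4. The chosen \<open>w\<close> is the root of the linear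
  factor.\<close>

lemma double_root_identity:
  fixes e m w A B f2 f3 f4 :: "'a::field_char_0"
  assumes f: "f4 = 3 * (e - m ^ 2 - m) + 1 / 4"
      "f3 = 3 * e ^ 2 - 3 * e * m - 6 * e * m ^ 2 + 8 * m ^ 3 - A"
      "f2 = e ^ 3 - 3 * e ^ 2 * m ^ 2 - B"
    and w: "A \<noteq> 0" "w = - B / A"
  shows "(w ^ 3 + (1 / 2 + 3 * (e - m)) * w ^ 2 + 3 * e * (e - m) * w + e ^ 3) ^ 2 =
    (w ^ 2 + 2 * (e - m) * w + e ^ 2) ^ 3 + (w ^ 5 + f4 * w ^ 4 + f3 * w ^ 3 + f2 * w ^ 2)"
proof -
  have "A * w + B = 0"
    using w by simp
  have "(w ^ 3 + (1 / 2 + 3 * (e - m)) * w ^ 2 + 3 * e * (e - m) * w + e ^ 3) ^ 2 =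
      (w ^ 2 + 2 * (e - m) * w + e ^ 2) ^ 3 + (w ^ 5 + f4 * w ^ 4 + f3 * w ^ 3 + f2 * w ^ 2) +
      w ^ 2 * (A * w + B)"
    unfolding f by (simp add: field_simps) algebra
  then show ?thesis
    unfolding \<open>A * w + B = 0\<close> by simp
qed

lemma section_if_rational_double_root:
  fixes r f2 f3 f4 :: rat
  assumes f: "\<And>w. base_change f (w + of_rat r) =
      w ^ 5 + of_rat f4 * w ^ 4 + of_rat f3 * w ^ 3 + of_rat f2 * w ^ 2"
  shows "(\<exists>\<psi>. nonconstant \<psi> \<and> elliptic 0 (base_change f \<psi>) \<and> has_non_torsion_section f \<psi>) \<and>
     zariski_dense_in (rational_points (surface f)) (surface f)"
proof -
  define t where "t = indet"
  define g2 g3 g4 :: ratfun where "g2 = of_rat f2" and "g3 = of_rat f3" and "g4 = of_rat f4"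
  \<comment> \<open>The parameters of the identity are \<open>m = 1 / t\<close> and
    \<open>e = E / t^2\<close>, where \<open>E\<close> solves the condition on \<open>f4\<close>.
    The capital letters arise by clearing the poles at \<open>t = 0\<close>.\<close>
  define E where "E = 1 + t + of_rat ((f4 - 1 / 4) / 3) * t ^ 2"
  define A where "A = 3 * E ^ 2 - 3 * E * t - 6 * E + 8 * t - g3 * t ^ 4"
  define B where "B = E ^ 3 - 3 * E ^ 2 - g2 * t ^ 6"
  define W where "W = - B / A"
  define Y where "Y = W ^ 2 + 2 * (E - t) * W + E ^ 2"
  define K where "K = W ^ 5 + g4 * t ^ 2 * W ^ 4 + g3 * t ^ 4 * W ^ 3 + g2 * t ^ 6 * W ^ 2"
  define w where "w = W / t ^ 2"
  define y where "y = w ^ 2 + 2 * (E / t ^ 2 - 1 / t) * w + (E / t ^ 2) ^ 2"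
  define k where "k = w ^ 5 + g4 * w ^ 4 + g3 * w ^ 3 + g2 * w ^ 2"
  have t: "has_value 0 t 0"
    unfolding t_def by (rule has_value_indet)
  have t0: "t \<noteq> 0"
    by (rule has_value_neq_0[of 1 _ 1]) (simp_all add: t_def has_value_indet)
  have "has_value 0 E (1 + 0 + (f4 - 1 / 4) / 3 * 0 ^ 2)"
    unfolding E_def by (intro has_value_intros t)
  then have E: "has_value 0 E 1"
    by simp
  have A: "has_value 0 A (- 3)"
    unfolding A_def g3_def
    by (rule has_value_eq, (rule has_value_intros t E)+, simp)
  have B: "has_value 0 B (- 2)"
    unfolding B_def g2_def
    by (rule has_value_eq, (rule has_value_intros t E)+, simp)
  have W: "has_value 0 W (- (2 / 3))"
    unfolding W_def
    by (rule has_value_eq, (rule has_value_intros A B)+, simp_all)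
  have Y: "has_value 0 Y (1 / 9)"
    unfolding Y_def
    by (rule has_value_eq, (rule has_value_intros W E t)+, simp add: power2_eq_square)
  have K: "has_value 0 K ((- (2 / 3)) ^ 5)"
    unfolding K_def g2_def g3_def g4_def
    by (rule has_value_eq, (rule has_value_intros W t)+, simp)
  have nz: "A \<noteq> 0" "Y \<noteq> 0" "K \<noteq> 0"
    using has_value_neq_0[OF A] has_value_neq_0[OF Y] has_value_neq_0[OF K] by simp_all
  have y_Y: "y = Y / t ^ 4"
    unfolding y_def Y_def w_def using t0 by (simp add: field_simps power_numeral_reduce)
  have k_K: "k = K / t ^ 10"
    unfolding k_def K_def w_def using t0 by (simp add: field_simps power_numeral_reduce)
  have g4: "g4 = 3 * (E / t ^ 2 - (1 / t) ^ 2 - 1 / t) + 1 / 4"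
    unfolding g4_def E_def using t0
    by (simp add: field_simps power_numeral_reduce of_rat_divide of_rat_diff of_rat_mult)
  have g3: "g3 = 3 * (E / t ^ 2) ^ 2 - 3 * (E / t ^ 2) * (1 / t) - 6 * (E / t ^ 2) * (1 / t) ^ 2 +
      8 * (1 / t) ^ 3 - A / t ^ 4"
    unfolding A_def using t0 by (simp add: field_simps power_numeral_reduce)
  have g2: "g2 = (E / t ^ 2) ^ 3 - 3 * (E / t ^ 2) ^ 2 * (1 / t) ^ 2 - B / t ^ 6"
    unfolding B_def using t0 by (simp add: field_simps power_numeral_reduce)
  have "A / t ^ 4 \<noteq> 0" "w = - (B / t ^ 6) / (A / t ^ 4)"
    using nz t0 by (simp_all add: w_def W_def field_simps power_numeral_reduce)
  from double_root_identity[OF g4 g3 g2 this] obtain x where x: "x ^ 2 = y ^ 3 + k"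
    unfolding y_def[symmetric] k_def[symmetric] by blast
  have bc: "base_change f (w + of_rat r) = k"
    unfolding k_def g2_def g3_def g4_def by (rule f)
  show ?thesis
  proof (rule section_conclusion[of x y f "w + of_rat r" 0, unfolded bc])
    show "x ^ 2 = y ^ 3 + k"
      by (rule x)
    show "y \<noteq> 0" "k \<noteq> 0"
      using nz t0 by (simp_all add: y_Y k_K)
    \<comment> \<open>For constant \<open>w\<close> the function \<open>W = w t^2\<close> would
      vanish at 0, but its value there is \<open>- 2 / 3\<close>.\<close>
    show "nonconstant (w + of_rat r)"
      unfolding nonconstant_def
    proof (intro allI notI)
      fix c assume "w + of_rat r = Fract [:c:] 1"
      then have W': "W = (Fract [:c:] 1 - of_rat r) * t ^ 2"
        using t0 by (simp add: w_def field_simps)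
      have "has_value 0 W ((c - r) * 0 ^ 2)"
        unfolding W'
        by (intro has_value_mult has_value_diff has_value_const has_value_of_rat has_value_power t)
      from has_value_unique[OF this W] show False
        by simp
    qed
    \<comment> \<open>At \<open>t = 0\<close> the pole of \<open>k\<close> has order 10 and that of
      \<open>y^3\<close> order 12.\<close>
    have "k / y ^ 3 = K * t ^ 2 / Y ^ 3"
      unfolding y_Y k_K using t0 nz by (simp add: field_simps power_numeral_reduce)
    moreover have "has_value 0 (K * t ^ 2 / Y ^ 3) 0"
      by (rule has_value_eq, (rule has_value_intros K Y t)+, simp_all)
    ultimately show "has_value 0 (k / y ^ 3) 0"
      by simp
  qed
qed

text \<open>With \<open>y = h\<close> and \<open>x = h x'\<close> the equation becomes the conic
  \<open>x'^2 = z^2 + (p + 1) z + q - r\<close>. The lines \<open>x' = z + 1 / t\<close> through a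
  rational point at infinity meet it where a linear equation in \<open>z\<close> holds, solved by
  \<open>z = Z / t\<close>.\<close>

lemma section_if_square_factor:
  fixes r p q :: rat
  assumes f: "\<And>z. base_change f z = (z - of_rat r) * (z ^ 2 + of_rat p * z + of_rat q) ^ 2"
  shows "(\<exists>\<psi>. nonconstant \<psi> \<and> elliptic 0 (base_change f \<psi>) \<and> has_non_torsion_section f \<psi>) \<and>
     zariski_dense_in (rational_points (surface f)) (surface f)"
proof -
  define t where "t = indet"
  define P Q R :: ratfun where "P = of_rat p" and "Q = of_rat q" and "R = of_rat r"
  define Z where "Z = (Q * t ^ 2 - R * t ^ 2 - 1) / (2 - (P + 1) * t)"
  define H where "H = Z ^ 2 + P * t * Z + Q * t ^ 2"
  define z where "z = Z / t"
  define h where "h = z ^ 2 + P * z + Q"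
  have t: "has_value 0 t 0"
    unfolding t_def by (rule has_value_indet)
  have t0: "t \<noteq> 0"
    by (rule has_value_neq_0[of 1 _ 1]) (simp_all add: t_def has_value_indet)
  have "has_value 0 (2 - (P + 1) * t) (2 - (p + 1) * 0)"
    unfolding P_def by (intro has_value_intros t)
  then have D: "has_value 0 (2 - (P + 1) * t) 2"
    by simp
  then have D0: "2 - (P + 1) * t \<noteq> 0"
    by (rule has_value_neq_0) simp
  have Z: "has_value 0 Z (- (1 / 2))"
    unfolding Z_def Q_def R_def
    by (rule has_value_eq, (rule has_value_intros t D)+, simp_all)
  have H: "has_value 0 H (1 / 4)"
    unfolding H_def P_def Q_def
    by (rule has_value_eq, (rule has_value_intros t Z)+, simp add: power2_eq_square)
  have ZR: "has_value 0 (Z - R * t) (- (1 / 2))"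
    unfolding R_def
    by (rule has_value_eq, (rule has_value_intros t Z)+, simp)
  have nz: "H \<noteq> 0" "Z - R * t \<noteq> 0"
    using has_value_neq_0[OF H] has_value_neq_0[OF ZR] by simp_all
  have h_H: "h = H / t ^ 2"
    unfolding h_def H_def z_def using t0 by (simp add: field_simps power_numeral_reduce)
  have "Z * (2 - (P + 1) * t) = Q * t ^ 2 - R * t ^ 2 - 1"
    using D0 by (simp add: Z_def)
  then have "2 * Z + 1 = (P + 1) * Z * t + (Q - R) * t ^ 2"
    by algebra
  moreover have "Z = z * t"
    using t0 by (simp add: z_def)
  ultimately have "2 * i * z + i ^ 2 = (P + 1) * z + Q - R" if "i * t = 1" for i
    using that by algebra
  from this[of "1 / t"] have "2 * (1 / t) * z + (1 / t) ^ 2 = (P + 1) * z + Q - R"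
    using t0 by simp
  then have "(h * (z + 1 / t)) ^ 2 = h ^ 3 + (z - R) * h ^ 2"
    unfolding h_def by algebra
  moreover have bc: "base_change f z = (z - R) * h ^ 2"
    unfolding h_def P_def Q_def R_def by (rule f)
  ultimately have x: "(h * (z + 1 / t)) ^ 2 = h ^ 3 + base_change f z"
    by simp
  have zR: "z - R = (Z - R * t) / t"
    using t0 by (simp add: z_def field_simps)
  show ?thesis
  proof (rule section_conclusion[OF x])
    show "h \<noteq> 0" "base_change f z \<noteq> 0"
      using nz t0 by (simp_all add: bc h_H zR)
    show "nonconstant z"
      unfolding nonconstant_def
    proof (intro allI notI)
      fix c assume "z = Fract [:c:] 1"
      then have Z': "Z = Fract [:c:] 1 * t"
        using t0 by (simp add: z_def field_simps)
      have "has_value 0 Z (c * 0)"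
        unfolding Z' by (intro has_value_mult has_value_const t)
      from has_value_unique[OF this Z] show False
        by simp
    qed
    have "base_change f z / h ^ 3 = (Z - R * t) * t / H"
      unfolding bc h_H zR using t0 nz by (simp add: field_simps power_numeral_reduce)
    moreover have "has_value 0 ((Z - R * t) * t / H) 0"
      by (rule has_value_eq, (rule has_value_divide has_value_mult ZR H t)+, simp_all)
    ultimately show "has_value 0 (base_change f z / h ^ 3) 0"
      by simp
  qed
qed

section \<open>Repeated factors over the rationals\<close>

lemma map_poly_of_rat_mult:
  "map_poly of_rat (p * q) = (map_poly of_rat p * map_poly of_rat q :: 'a::field_char_0 poly)"
  by (rule poly_eqI) (simp add: coeff_map_poly coeff_mult of_rat_sum of_rat_mult)

lemma map_poly_of_rat_add:
  "map_poly of_rat (p + q) = (map_poly of_rat p + map_poly of_rat q :: 'a::field_char_0 poly)"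
  by (rule poly_eqI) (simp add: coeff_map_poly of_rat_add)

lemma map_poly_of_rat_of_int:
  "map_poly of_rat (map_poly of_int f) = (map_poly of_int f :: 'a::field_char_0 poly)"
  by (rule poly_eqI) (simp add: coeff_map_poly)

lemma pderiv_map_poly_of_rat:
  "pderiv (map_poly of_rat p) = (map_poly of_rat (pderiv p) :: 'a::field_char_0 poly)"
  by (rule poly_eqI) (simp add: coeff_map_poly coeff_pderiv of_rat_mult del: of_nat_Suc)

lemma pderiv_square_mult:
  "pderiv (p ^ 2 * q) = p * (2 * pderiv p * q + p * pderiv q)" for p q :: "'a::idom poly"
  by (simp add: power2_eq_square pderiv_mult algebra_simps)

text \<open>A non-zero rational \<open>h\<close> of least degree vanishing at the multiple root
  divides every rational polynomial that vanishes there, and its derivative does not vanish there.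
  So in \<open>F = h g\<close> the derivative of \<open>F\<close> forces \<open>g\<close> to vanish
  as well, and \<open>h\<close> divides \<open>g\<close>.\<close>

lemma repeated_factor:
  assumes "has_multiple_root f" "f \<noteq> 0"
  obtains h l :: "rat poly" where "degree h > 0" "map_poly of_int f = h ^ 2 * l"
proof -
  define F where "F = (map_poly of_int f :: rat poly)"
  define FC where "FC = (map_poly of_int f :: complex poly)"
  have FC: "map_poly of_rat F = FC"
    unfolding F_def FC_def by (rule map_poly_of_rat_of_int)
  obtain \<alpha> where "order \<alpha> FC \<ge> 2"
    using assms(1) unfolding has_multiple_root_def FC_def by blast
  then obtain g where g: "FC = [:- \<alpha>, 1:] ^ 2 * g"
    using order_divides by blast
  define ev where "ev p = poly (map_poly of_rat p) \<alpha>" for p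
  have ev_mult: "ev (p * q) = ev p * ev q" and ev_add: "ev (p + q) = ev p + ev q" for p q
    by (simp_all add: ev_def map_poly_of_rat_mult map_poly_of_rat_add)
  have "poly FC \<alpha> = 0" "poly (pderiv FC) \<alpha> = 0"
    unfolding g pderiv_square_mult by (simp_all del: mult_pCons_left)
  then have root: "ev F = 0" "ev (pderiv F) = 0"
    by (simp_all add: ev_def FC flip: pderiv_map_poly_of_rat)
  have "F \<noteq> 0"
    using assms(2) unfolding F_def by (metis coeff_0 coeff_map_poly of_int_0 of_int_0_eq_iff poly_eqI)
  define h where "h = arg_min degree (\<lambda>p. p \<noteq> 0 \<and> ev p = 0)"
  have "h \<noteq> 0 \<and> ev h = 0"
    unfolding h_def by (rule arg_min_natI[of _ F]) (use root \<open>F \<noteq> 0\<close> in simp)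
  then have h: "h \<noteq> 0" "ev h = 0"
    by simp_all
  have min: "p = 0" if "ev p = 0" "degree p < degree h" for p
    using arg_min_nat_le[of "\<lambda>p. p \<noteq> 0 \<and> ev p = 0" p degree] that unfolding h_def by fastforce
  have dvd: "h dvd p" if "ev p = 0" for p
  proof -
    have "ev p = ev (p div h) * ev h + ev (p mod h)"
      by (metis ev_add ev_mult div_mult_mod_eq)
    then have "ev (p mod h) = 0"
      using that h(2) by simp
    then have "p mod h = 0"
      using min degree_mod_less[OF h(1), of p] by blast
    then show ?thesis
      by blast
  qed
  have deg: "degree h > 0"
  proof (rule ccontr)
    assume "\<not> degree h > 0"
    then obtain c where "h = [:c:]"
      using degree_eq_zeroE by blast
    then show False
      using h by (simp add: ev_def map_poly_pCons)
  qed
  then have "pderiv h \<noteq> 0" "degree (pderiv h) < degree h"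
    by (simp_all add: pderiv_eq_0_iff degree_pderiv)
  then have "ev (pderiv h) \<noteq> 0"
    using min by blast
  obtain g where F: "F = h * g"
    using dvd[OF root(1)] by blast
  have "ev (pderiv F) = ev h * ev (pderiv g) + ev g * ev (pderiv h)"
    by (simp add: F pderiv_mult ev_mult ev_add)
  then have "ev g = 0"
    using root(2) h(2) \<open>ev (pderiv h) \<noteq> 0\<close> by simp
  then obtain l where "g = h * l"
    using dvd by blast
  then have "F = h ^ 2 * l"
    using F by (simp add: power2_eq_square mult.assoc)
  then show ?thesis
    using that deg unfolding F_def by blast
qed

lemma degree_1_poly:
  assumes "degree p = 1"
  obtains a b where "p = [:b, a:]" "a \<noteq> 0"
proof -
  have "p = [:coeff p 0, coeff p 1:]"
    by (rule poly_eqI) (use assms in \<open>auto simp: coeff_pCons coeff_eq_0 split: nat.splits\<close>)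
  moreover have "coeff p 1 \<noteq> 0"
    using assms by (metis leading_coeff_0_iff degree_0 zero_neq_one)
  ultimately show ?thesis
    using that by blast
qed

lemma degree_2_poly:
  assumes "degree p = 2"
  obtains a b c where "p = [:c, b, a:]" "a \<noteq> 0"
proof -
  have "p = [:coeff p 0, coeff p 1, coeff p 2:]"
    by (rule poly_eqI)
      (use assms in \<open>auto simp: coeff_pCons coeff_eq_0 numeral_2_eq_2 split: nat.splits\<close>)
  moreover have "coeff p 2 \<noteq> 0"
    using assms by (metis leading_coeff_0_iff degree_0 zero_neq_numeral)
  ultimately show ?thesis
    using that by blast
qed

text \<open>In \<open>F = h^2 l\<close> the degrees satisfy \<open>2 deg h + deg l = 5\<close>:
  either \<open>h\<close> is linear with a rational root, or \<open>h\<close> is quadratic and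
  \<open>l\<close> linear.\<close>

lemma multiple_root_cases:
  assumes "has_multiple_root f" "degree f = 5" "lead_coeff f = 1"
  obtains (double) r :: rat where "poly (map_poly of_int f) r = 0" "poly (pderiv (map_poly of_int f)) r = 0"
  | (square) r p q :: rat where "map_poly of_int f = [:- r, 1:] * [:q, p, 1:] ^ 2"
proof -
  define F where "F = (map_poly of_int f :: rat poly)"
  have lead: "coeff F 5 = 1"
    using assms(2,3) by (simp add: F_def coeff_map_poly)
  have deg: "degree F = 5"
    using assms(2) unfolding F_def by (subst degree_map_poly) auto
  obtain h l where h: "degree h > 0" "F = h ^ 2 * l"
    using repeated_factor[OF assms(1)] assms(2) unfolding F_def by (metis degree_0 zero_neq_numeral)
  then have nz: "h \<noteq> 0" "l \<noteq> 0"
    using deg by auto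
  then have sum: "2 * degree h + degree l = 5"
    using deg h(2) by (simp add: degree_mult_eq degree_power_eq)
  then have "degree h = 1 \<or> degree h = 2 \<and> degree l = 1"
    using h(1) by presburger
  then consider "degree h = 1" | "degree h = 2" "degree l = 1"
    by blast
  then show ?thesis
  proof cases
    case 1
    then obtain u v where "h = [:v, u:]" "u \<noteq> 0"
      by (rule degree_1_poly)
    then have "poly h (- v / u) = 0"
      by simp
    then have "poly F (- v / u) = 0" "poly (pderiv F) (- v / u) = 0"
      using h(2) by (simp_all add: pderiv_square_mult)
    then show ?thesis
      using double unfolding F_def by blast
  next
    case 2
    obtain a b c where h': "h = [:c, b, a:]" "a \<noteq> 0"
      using 2(1) by (rule degree_2_poly)
    obtain u v where l: "l = [:v, u:]" "u \<noteq> 0"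
      using 2(2) by (rule degree_1_poly)
    have "lead_coeff F = lead_coeff h ^ 2 * lead_coeff l"
      unfolding h(2) by (simp add: lead_coeff_mult lead_coeff_power)
    then have "a ^ 2 * u = 1"
      using lead deg h' l by simp
    have "h = smult a [:c / a, b / a, 1:]" "l = smult u [:- (- v / u), 1:]"
      using h' l by simp_all
    then have "F = smult (a ^ 2 * u) ([:- (- v / u), 1:] * [:c / a, b / a, 1:] ^ 2)"
      unfolding h(2) by (simp only: smult_power mult_smult_left mult_smult_right smult_smult mult.commute)
    then show ?thesis
      using square unfolding F_def \<open>a ^ 2 * u = 1\<close> smult_1_left by blast
  qed
qed

lemma base_change_quintic:
  "base_change [:d, c, b, a, 0, 1:] \<psi> =
    \<psi> ^ 5 + of_int a * \<psi> ^ 3 + of_int b * \<psi> ^ 2 + of_int c * \<psi> + of_int d"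
  by (simp add: base_change_def map_poly_pCons power_numeral_reduce algebra_simps)

lemma multiple_root_case:
  assumes f: "f = [:d, c, b, a, 0, 1:]" and "has_multiple_root f"
  shows "(\<exists>\<psi>. nonconstant \<psi> \<and> elliptic 0 (base_change f \<psi>) \<and> has_non_torsion_section f \<psi>) \<and>
     zariski_dense_in (rational_points (surface f)) (surface f)"
proof -
  have "degree f = 5" "lead_coeff f = 1"
    by (simp_all add: f)
  with assms(2) show ?thesis
  proof (cases rule: multiple_root_cases)
    case (double r)
    define R :: ratfun where "R = of_rat r"
    have "r ^ 5 + of_int a * r ^ 3 + of_int b * r ^ 2 + of_int c * r + of_int d = 0"
        "5 * r ^ 4 + 3 * of_int a * r ^ 2 + 2 * of_int b * r + of_int c = 0"
      using double unfolding f
      by (simp_all add: map_poly_pCons pderiv_pCons algebra_simps power_numeral_reduce)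
    from this[THEN arg_cong[where f = "of_rat :: rat \<Rightarrow> ratfun"]]
    have R: "R ^ 5 + of_int a * R ^ 3 + of_int b * R ^ 2 + of_int c * R + of_int d = 0"
        "5 * R ^ 4 + 3 * of_int a * R ^ 2 + 2 * of_int b * R + of_int c = 0"
      by (simp_all add: R_def of_rat_add of_rat_mult of_rat_power)
    \<comment> \<open>The Taylor expansion at \<open>r\<close>, whose constant and linear terms
      vanish at a double root.\<close>
    have "base_change f (w + of_rat r) = w ^ 5 + of_rat (5 * r) * w ^ 4 +
        of_rat (10 * r ^ 2 + of_int a) * w ^ 3 +
        of_rat (10 * r ^ 3 + 3 * of_int a * r + of_int b) * w ^ 2" for w
    proof -
      have "(w + R) ^ 5 + of_int a * (w + R) ^ 3 + of_int b * (w + R) ^ 2 + of_int c * (w + R) + of_int d =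
        w ^ 5 + (5 * R) * w ^ 4 + (10 * R ^ 2 + of_int a) * w ^ 3 +
        (10 * R ^ 3 + 3 * of_int a * R + of_int b) * w ^ 2"
        using R by algebra
      then show ?thesis
        unfolding f base_change_quintic by (simp add: R_def of_rat_add of_rat_mult of_rat_power)
    qed
    then show ?thesis
      by (rule section_if_rational_double_root)
  next
    case (square r p q)
    have "base_change f z = poly (map_poly of_rat (map_poly of_int f)) z" for z
      by (simp add: base_change_def map_poly_of_rat_of_int)
    then have "base_change f z = (z - of_rat r) * (z ^ 2 + of_rat p * z + of_rat q) ^ 2" for z
      unfolding square power2_eq_square map_poly_of_rat_mult poly_mult
      by (simp add: map_poly_pCons of_rat_minus algebra_simps)
    then show ?thesis
      by (rule section_if_square_factor)
  qed
qed

section \<open>Functions on a curve with one point at infinity\<close>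

text \<open>The coordinate ring of the affine curve \<open>v^2 = g(u)\<close>; its elements are
  functions of two real variables of which only the values on the curve matter.\<close>

definition regular_on :: "real poly \<Rightarrow> (real \<Rightarrow> real \<Rightarrow> real) \<Rightarrow> bool" where
  "regular_on g \<Phi> \<longleftrightarrow>
    (\<exists>\<alpha> \<beta>. \<forall>u v. v ^ 2 = poly g u \<longrightarrow> \<Phi> u v = poly \<alpha> u + poly \<beta> u * v)"

lemma regular_on_const: "regular_on g (\<lambda>u v. c)"
  unfolding regular_on_def by (rule exI[of _ "[:c:]"], rule exI[of _ 0]) simp

lemma regular_on_fst: "regular_on g (\<lambda>u v. u)"
  unfolding regular_on_def by (rule exI[of _ "[:0, 1:]"], rule exI[of _ 0]) simp

lemma regular_on_snd: "regular_on g (\<lambda>u v. v)"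
  unfolding regular_on_def by (rule exI[of _ 0], rule exI[of _ 1]) simp

lemma regular_on_add:
  assumes "regular_on g \<Phi>" "regular_on g \<Psi>"
  shows "regular_on g (\<lambda>u v. \<Phi> u v + \<Psi> u v)"
proof -
  obtain \<alpha> \<beta> \<alpha>' \<beta>' where "\<And>u v. v ^ 2 = poly g u \<Longrightarrow> \<Phi> u v = poly \<alpha> u + poly \<beta> u * v"
      "\<And>u v. v ^ 2 = poly g u \<Longrightarrow> \<Psi> u v = poly \<alpha>' u + poly \<beta>' u * v"
    using assms unfolding regular_on_def by metis
  then show ?thesis
    unfolding regular_on_def
    by (intro exI[of _ "\<alpha> + \<alpha>'"] exI[of _ "\<beta> + \<beta>'"]) (simp add: algebra_simps)
qed

lemma regular_on_mult:
  assumes "regular_on g \<Phi>" "regular_on g \<Psi>"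
  shows "regular_on g (\<lambda>u v. \<Phi> u v * \<Psi> u v)"
proof -
  obtain \<alpha> \<beta> \<alpha>' \<beta>' where *: "\<And>u v. v ^ 2 = poly g u \<Longrightarrow> \<Phi> u v = poly \<alpha> u + poly \<beta> u * v"
      "\<And>u v. v ^ 2 = poly g u \<Longrightarrow> \<Psi> u v = poly \<alpha>' u + poly \<beta>' u * v"
    using assms unfolding regular_on_def by metis
  have "\<Phi> u v * \<Psi> u v = poly (\<alpha> * \<alpha>' + \<beta> * \<beta>' * g) u + poly (\<alpha> * \<beta>' + \<alpha>' * \<beta>) u * v"
    if "v ^ 2 = poly g u" for u v
    unfolding *[OF that] by (simp add: that[symmetric] power2_eq_square algebra_simps)
  then show ?thesis
    unfolding regular_on_def by blast
qed

lemma regular_on_minus: "regular_on g \<Phi> \<Longrightarrow> regular_on g (\<lambda>u v. - \<Phi> u v)"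
  using regular_on_mult[OF regular_on_const[of g "- 1"]] by simp

lemma regular_on_diff:
  "regular_on g \<Phi> \<Longrightarrow> regular_on g \<Psi> \<Longrightarrow> regular_on g (\<lambda>u v. \<Phi> u v - \<Psi> u v)"
  using regular_on_add[OF _ regular_on_minus] by fastforce

lemma regular_on_divide: "regular_on g \<Phi> \<Longrightarrow> regular_on g (\<lambda>u v. \<Phi> u v / c)"
  using regular_on_mult[OF _ regular_on_const[of g "1 / c"]] by simp

lemma regular_on_power: "regular_on g \<Phi> \<Longrightarrow> regular_on g (\<lambda>u v. \<Phi> u v ^ n)"
  by (induction n) (simp_all add: regular_on_const regular_on_mult)

lemmas regular_on_intros =
  regular_on_const regular_on_fst regular_on_snd regular_on_add regular_on_mult regular_on_minus
  regular_on_diff regular_on_divide regular_on_power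

text \<open>At a zero of \<open>\<Phi>\<close> the norm \<open>\<alpha>^2 - \<beta>^2 g\<close>
  vanishes at \<open>u\<close>. By the odd degree of \<open>g\<close> it is a non-zero polynomial,
  so finitely many \<open>u\<close> occur, each with finitely many \<open>v\<close>.\<close>

lemma regular_on_finite_zeros:
  assumes g: "odd (degree g)" and "regular_on g \<Phi>"
    and nz: "v\<^sub>0 ^ 2 = poly g u\<^sub>0" "\<Phi> u\<^sub>0 v\<^sub>0 \<noteq> 0"
  shows "finite {(u, v). v ^ 2 = poly g u \<and> \<Phi> u v = 0}"
proof -
  obtain \<alpha> \<beta> where \<Phi>: "\<And>u v. v ^ 2 = poly g u \<Longrightarrow> \<Phi> u v = poly \<alpha> u + poly \<beta> u * v"
    using assms(2) unfolding regular_on_def by blast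
  have "\<alpha> ^ 2 - \<beta> ^ 2 * g \<noteq> 0"
    using square_times_odd_degree[of \<alpha> \<beta> g] g nz \<Phi> by auto
  then have fin_u: "finite {u. poly (\<alpha> ^ 2 - \<beta> ^ 2 * g) u = 0}"
    by (rule poly_roots_finite)
  have norm: "poly (\<alpha> ^ 2 - \<beta> ^ 2 * g) u = 0" if uv: "v ^ 2 = poly g u" "\<Phi> u v = 0" for u v
  proof -
    have "poly \<alpha> u = - (poly \<beta> u * v)"
      using \<Phi>[OF uv(1)] uv(2) by simp
    then have "poly \<alpha> u ^ 2 = poly \<beta> u ^ 2 * v ^ 2"
      by (simp add: power_mult_distrib)
    then show ?thesis
      using uv(1) by simp
  qed
  have fin_v: "finite {v. v ^ 2 = poly g u}" for u
  proof -
    have "{v. v ^ 2 = poly g u} = {v. poly [:- poly g u, 0, 1:] v = 0}"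
      by (auto simp: power2_eq_square)
    then show ?thesis
      by (simp only:) (rule poly_roots_finite, simp)
  qed
  have "finite (SIGMA u:{u. poly (\<alpha> ^ 2 - \<beta> ^ 2 * g) u = 0}. {v. v ^ 2 = poly g u})"
    using fin_u fin_v by (rule finite_SigmaI)
  then show ?thesis
    by (rule rev_finite_subset) (use norm in auto)
qed

section \<open>Points from the auxiliary curve\<close>

text \<open>
  With \<open>y = w\<^sup>2 + R\<close> and \<open>x = w\<^sup>3 + w\<^sup>2/2 + V w + W\<close> the polynomial \<open>x\<^sup>2 - y\<^sup>3 - f(w + u)\<close> has degree
  at most 5 in \<open>w\<close>; \<open>R\<close>, \<open>V\<close> and \<open>W\<close> annihilate its coefficients of \<open>w\<^sup>5\<close>, \<open>w\<^sup>4\<close> and \<open>w\<^sup>3\<close>, and the curve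
  \<open>E\<^sub>a\<^sub>,\<^sub>b\<close> is the vanishing of the coefficient of \<open>w\<^sup>2\<close>. The remaining \<open>A w + B\<close> has a rational root,
  which yields the point with \<open>z = N / A\<close>, \<open>y = M / A\<^sup>2\<close> and \<open>f(z) = K / A\<^sup>5\<close>.
\<close>

context
  fixes a b c d :: "'a::field_char_0"
begin

definition ptV :: "'a \<Rightarrow> 'a \<Rightarrow> 'a" where "ptV u v = v + 10 * u - 5 / 4"
definition ptR :: "'a \<Rightarrow> 'a \<Rightarrow> 'a" where "ptR u v = (2 * ptV u v - 5 * u + 1 / 4) / 3"
definition ptW :: "'a \<Rightarrow> 'a \<Rightarrow> 'a" where "ptW u v = (10 * u ^ 2 + a - ptV u v) / 2"
definition ptA :: "'a \<Rightarrow> 'a \<Rightarrow> 'a" where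
  "ptA u v = 2 * ptV u v * ptW u v - (5 * u ^ 4 + 3 * a * u ^ 2 + 2 * b * u + c)"
definition ptB :: "'a \<Rightarrow> 'a \<Rightarrow> 'a" where
  "ptB u v = ptW u v ^ 2 - ptR u v ^ 3 - (u ^ 5 + a * u ^ 3 + b * u ^ 2 + c * u + d)"
definition ptN :: "'a \<Rightarrow> 'a \<Rightarrow> 'a" where "ptN u v = u * ptA u v - ptB u v"
definition ptM :: "'a \<Rightarrow> 'a \<Rightarrow> 'a" where "ptM u v = ptB u v ^ 2 + ptR u v * ptA u v ^ 2"
definition ptK :: "'a \<Rightarrow> 'a \<Rightarrow> 'a" where
  "ptK u v = ptN u v ^ 5 + a * ptN u v ^ 3 * ptA u v ^ 2 + b * ptN u v ^ 2 * ptA u v ^ 3 +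
    c * ptN u v * ptA u v ^ 4 + d * ptA u v ^ 5"

text \<open>The right-hand side of the auxiliary curve after \<open>X = 30 - 30 u\<close>,
  \<open>Y = 30 v\<close>. The shift in \<open>ptV\<close> completes the square in the vanishing
  coefficient of \<open>w^2\<close>, which is quadratic in \<open>V\<close>.\<close>

definition cubic :: "'a poly" where
  "cubic = [:3 / 2 + 3 * a / 2 - 3 * b, - (9 * a + 45 / 2), 90, - 30:]"

lemma point_from_curve:
  assumes "v ^ 2 = poly cubic u" and A: "ptA u v \<noteq> 0"
  defines "z \<equiv> ptN u v / ptA u v" and "y \<equiv> ptM u v / ptA u v ^ 2"
  shows "\<exists>x. x ^ 2 = y ^ 3 + (z ^ 5 + a * z ^ 3 + b * z ^ 2 + c * z + d)"
    and "z ^ 5 + a * z ^ 3 + b * z ^ 2 + c * z + d = ptK u v / ptA u v ^ 5"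
proof -
  define V where "V = ptV u v"
  define R where "R = ptR u v"
  define W where "W = ptW u v"
  define w where "w = - (ptB u v / ptA u v)"
  have z: "z = w + u" and y: "y = w ^ 2 + R"
    using A by (simp_all add: z_def y_def w_def ptN_def ptM_def R_def field_simps power2_eq_square)
  have Aw: "ptA u v * w + ptB u v = 0"
    using A by (simp add: w_def)
  \<comment> \<open>Comparison of \<open>x^2\<close> with \<open>y^3 + f(w + u)\<close> in degrees 4
    and 3 in \<open>w\<close>; the next relation is degree 2, where the curve equation
    enters.\<close>
  have "1 / 4 + 2 * V = 3 * R + 5 * u" "2 * W + V = 10 * u ^ 2 + a"
    by (simp_all add: R_def W_def V_def ptR_def ptW_def field_simps)
  moreover have "V ^ 2 + W = 3 * R ^ 2 + 10 * u ^ 3 + 3 * a * u + b"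
  proof -
    have v: "v = V - 10 * u + 5 / 4"
      by (simp add: V_def ptV_def)
    have "v ^ 2 = 3 / 2 + 3 * a / 2 - 3 * b - (9 * a + 45 / 2) * u + 90 * u ^ 2 - 30 * u ^ 3"
      using assms(1) by (simp add: cubic_def algebra_simps power_numeral_reduce)
    then have "(V - 10 * u + 5 / 4) ^ 2 =
        3 / 2 + 3 * a / 2 - 3 * b - (9 * a + 45 / 2) * u + 90 * u ^ 2 - 30 * u ^ 3"
      unfolding v .
    moreover have "R = (2 * V - 5 * u + 1 / 4) / 3" "W = (10 * u ^ 2 + a - V) / 2"
      by (simp_all add: R_def W_def V_def ptR_def ptW_def)
    ultimately show ?thesis
      by (simp add: field_simps) algebra
  qed
  moreover have "ptA u v = 2 * V * W - (5 * u ^ 4 + 3 * a * u ^ 2 + 2 * b * u + c)"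
      "ptB u v = W ^ 2 - R ^ 3 - (u ^ 5 + a * u ^ 3 + b * u ^ 2 + c * u + d)"
    by (simp_all add: ptA_def ptB_def V_def W_def R_def)
  ultimately have "(2 * w ^ 3 + w ^ 2 + 2 * V * w + 2 * W) ^ 2 = 
      4 * (y ^ 3 + (z ^ 5 + a * z ^ 3 + b * z ^ 2 + c * z + d))"
    using Aw unfolding z y by algebra
  then have "((2 * w ^ 3 + w ^ 2 + 2 * V * w + 2 * W) / 2) ^ 2 = 
      y ^ 3 + (z ^ 5 + a * z ^ 3 + b * z ^ 2 + c * z + d)"
    by (simp add: power_divide)
  then show "\<exists>x. x ^ 2 = y ^ 3 + (z ^ 5 + a * z ^ 3 + b * z ^ 2 + c * z + d)"
    by blast
  show "z ^ 5 + a * z ^ 3 + b * z ^ 2 + c * z + d = ptK u v / ptA u v ^ 5"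
    unfolding z_def ptK_def using A by (simp add: field_simps power_numeral_reduce)
qed

end

text \<open>Transfer to the reals, where the point at infinity can be approached by limits.\<close>

lemma of_rat_pt:
  fixes a b c d u v :: rat
  defines "r \<equiv> of_rat :: rat \<Rightarrow> real"
  shows of_rat_ptA: "r (ptA a b c u v) = ptA (r a) (r b) (r c) (r u) (r v)"
    and of_rat_ptN: "r (ptN a b c d u v) = ptN (r a) (r b) (r c) (r d) (r u) (r v)"
    and of_rat_ptM: "r (ptM a b c d u v) = ptM (r a) (r b) (r c) (r d) (r u) (r v)"
    and of_rat_ptK: "r (ptK a b c d u v) = ptK (r a) (r b) (r c) (r d) (r u) (r v)"
    and of_rat_cubic: "r (poly (cubic a b) u) = poly (cubic (r a) (r b)) (r u)"
proof -
  note of_rat_simps = of_rat_add of_rat_diff of_rat_mult of_rat_divide of_rat_power of_rat_minus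
  have V: "r (ptV u v) = ptV (r u) (r v)"
    by (simp add: ptV_def r_def of_rat_simps)
  have R: "r (ptR u v) = ptR (r u) (r v)"
    using V by (simp add: ptR_def r_def of_rat_simps)
  have W: "r (ptW a u v) = ptW (r a) (r u) (r v)"
    using V by (simp add: ptW_def r_def of_rat_simps)
  show A: "r (ptA a b c u v) = ptA (r a) (r b) (r c) (r u) (r v)"
    using V W by (simp add: ptA_def r_def of_rat_simps)
  have B: "r (ptB a b c d u v) = ptB (r a) (r b) (r c) (r d) (r u) (r v)"
    using R W by (simp add: ptB_def r_def of_rat_simps)
  show N: "r (ptN a b c d u v) = ptN (r a) (r b) (r c) (r d) (r u) (r v)"
    using A B by (simp add: ptN_def r_def of_rat_simps)
  show "r (ptM a b c d u v) = ptM (r a) (r b) (r c) (r d) (r u) (r v)"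
    using A B R by (simp add: ptM_def r_def of_rat_simps)
  show "r (ptK a b c d u v) = ptK (r a) (r b) (r c) (r d) (r u) (r v)"
    using A N by (simp add: ptK_def r_def of_rat_simps)
  show "r (poly (cubic a b) u) = poly (cubic (r a) (r b)) (r u)"
    by (simp add: cubic_def r_def of_rat_simps)
qed

text \<open>
  The functions are compared through their pole orders at the point at infinity, approached along
  \<open>u = - 1 / i\<^sup>2\<close>, \<open>v = s / i\<^sup>3\<close> with \<open>i \<rightarrow> 0\<close> and \<open>s \<rightarrow> sqrt 30\<close>; the letters below denote the
  functions multiplied by the power of \<open>i\<close> that makes them finite at \<open>i = 0\<close>.
\<close>

lemma finite_zeros_from_infinity:
  fixes a b c d \<kappa> \<zeta> :: real
  defines "Z \<Phi> \<equiv> {(u, v). v ^ 2 = poly (cubic a b) u \<and> \<Phi> u v = 0}"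
  shows "finite (Z (ptA a b c))" "finite (Z (ptK a b c d))"
    "finite (Z (\<lambda>u v. ptN a b c d u v - \<zeta> * ptA a b c u v))"
    "finite (Z (\<lambda>u v. ptM a b c d u v ^ 3 - \<kappa> * (ptA a b c u v * ptK a b c d u v)))"
proof -
  define G where "G i = 30 + 90 * i ^ 2 + (9 * a + 45 / 2) * i ^ 4 + (3 / 2 + 3 * a / 2 - 3 * b) * i ^ 6" for i
  define s where "s i = sqrt (G i)" for i
  define V where "V i = s i - 10 * i - 5 / 4 * i ^ 3" for i
  define R where "R i = (2 * V i + 5 * i + i ^ 3 / 4) / 3" for i
  define W where "W i = (10 + a * i ^ 4 - i * V i) / 2" for i
  define A where "A i = 2 * i * V i * W i - (5 + 3 * a * i ^ 4 - 2 * b * i ^ 6 + c * i ^ 8)" for i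
  define B where "B i = W i ^ 2 * i ^ 2 - R i ^ 3 * i - (- 1 - a * i ^ 4 + b * i ^ 6 - c * i ^ 8 + d * i ^ 10)" for i
  define N where "N i = - A i - B i" for i
  define M where "M i = B i ^ 2 + i * R i * A i ^ 2" for i
  define K where "K i = N i ^ 5 + a * N i ^ 3 * A i ^ 2 * i ^ 4 + b * N i ^ 2 * A i ^ 3 * i ^ 6 +
    c * N i * A i ^ 4 * i ^ 8 + d * A i ^ 5 * i ^ 10" for i
  have cG: "isCont G 0" and cs: "isCont s 0"
    unfolding s_def G_def by (intro continuous_intros)+
  have cV: "isCont V 0" unfolding V_def by (intro continuous_intros cs)
  have cR: "isCont R 0" unfolding R_def by (intro continuous_intros cV) simp_all
  have cW: "isCont W 0" unfolding W_def by (intro continuous_intros cV) simp_all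
  have cA: "isCont A 0" unfolding A_def by (intro continuous_intros cV cW)
  have cB: "isCont B 0" unfolding B_def by (intro continuous_intros cR cW)
  have cN: "isCont N 0" unfolding N_def by (intro continuous_intros cA cB)
  have cM: "isCont M 0" unfolding M_def by (intro continuous_intros cA cB cR)
  have cK: "isCont K 0" unfolding K_def by (intro continuous_intros cA cN)
  \<comment> \<open>These leading coefficients are non-zero, so the pole orders in \<open>i\<close>
    are exactly 8, 10, 20 and 50.\<close>
  have A0: "A 0 = - 5" and N0: "N 0 = 4" and M0: "M 0 = 1" and K0: "K 0 = 4 ^ 5"
    by (simp_all add: A_def B_def N_def M_def K_def)
  define p where "p i = - 1 / i ^ 2" for i :: real
  define q where "q i = s i / i ^ 3" for i
  have V: "ptV (p i) (q i) = V i / i ^ 3" if "i > 0" for i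
    unfolding ptV_def V_def p_def q_def using that by (simp add: field_simps power_numeral_reduce)
  have R: "ptR (p i) (q i) = R i / i ^ 3" if "i > 0" for i
    unfolding ptR_def R_def V[OF that] unfolding p_def using that by (simp add: field_simps power_numeral_reduce)
  have W: "ptW a (p i) (q i) = W i / i ^ 4" if "i > 0" for i
    unfolding ptW_def W_def V[OF that] unfolding p_def using that by (simp add: field_simps power_numeral_reduce)
  have A: "ptA a b c (p i) (q i) = A i / i ^ 8" if "i > 0" for i
    unfolding ptA_def A_def V[OF that] W[OF that] unfolding p_def using that
    by (simp add: field_simps power_numeral_reduce)
  have B: "ptB a b c d (p i) (q i) = B i / i ^ 10" if "i > 0" for i
    unfolding ptB_def B_def R[OF that] W[OF that] unfolding p_def using that
    by (simp add: field_simps power_numeral_reduce)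
  have N: "ptN a b c d (p i) (q i) = N i / i ^ 10" if "i > 0" for i
    unfolding ptN_def N_def A[OF that] B[OF that] unfolding p_def using that
    by (simp add: field_simps power_numeral_reduce)
  have M: "ptM a b c d (p i) (q i) = M i / i ^ 20" if "i > 0" for i
    unfolding ptM_def M_def A[OF that] B[OF that] R[OF that] using that
    by (simp add: field_simps power_numeral_reduce)
  have K: "ptK a b c d (p i) (q i) = K i / i ^ 50" if "i > 0" for i
  proof -
    have i50: "i ^ 50 = (i ^ 10) ^ 5" "i ^ 50 = (i ^ 10) ^ 3 * (i ^ 8) ^ 2 * i ^ 4"
        "i ^ 50 = (i ^ 10) ^ 2 * (i ^ 8) ^ 3 * i ^ 6" "i ^ 50 = i ^ 10 * (i ^ 8) ^ 4 * i ^ 8"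
        "i ^ 50 = (i ^ 8) ^ 5 * i ^ 10"
      by (simp_all flip: power_add power_mult)
    have cancel: "\<alpha> * P * Q * e / (p * q * e) = \<alpha> * (P / p) * (Q / q)" if "e \<noteq> 0"
      for \<alpha> P Q e p q :: real
      using that by simp
    have "N i ^ 5 / i ^ 50 = (N i / i ^ 10) ^ 5"
      unfolding i50(1) by (rule power_divide[symmetric])
    moreover have "a * N i ^ 3 * A i ^ 2 * i ^ 4 / i ^ 50 = a * (N i / i ^ 10) ^ 3 * (A i / i ^ 8) ^ 2"
      unfolding i50(2) power_divide by (rule cancel) (use that in simp)
    moreover have "b * N i ^ 2 * A i ^ 3 * i ^ 6 / i ^ 50 = b * (N i / i ^ 10) ^ 2 * (A i / i ^ 8) ^ 3"
      unfolding i50(3) power_divide by (rule cancel) (use that in simp)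
    moreover have "c * N i * A i ^ 4 * i ^ 8 / i ^ 50 = c * (N i / i ^ 10) * (A i / i ^ 8) ^ 4"
      unfolding i50(4) power_divide by (rule cancel) (use that in simp)
    moreover have "d * A i ^ 5 * i ^ 10 / i ^ 50 = d * (A i / i ^ 8) ^ 5"
      unfolding i50(5) power_divide
      by (subst mult_divide_mult_cancel_right) (use that in simp_all)
    ultimately show ?thesis
      unfolding ptK_def K_def A[OF that] N[OF that] add_divide_distrib by (simp only:)
  qed
  \<comment> \<open>Near infinity \<open>\<Psi>\<close> stays non-zero and \<open>G\<close>
    positive, so \<open>(p i, q i)\<close> is a real point of the curve at which
    \<open>\<Phi>\<close> does not vanish.\<close>
  have zeros: "finite (Z \<Phi>)"
    if reg: "regular_on (cubic a b) \<Phi>" and cont: "isCont \<Psi> 0" "\<Psi> 0 \<noteq> 0"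
      and eq: "\<And>i. i > 0 \<Longrightarrow> \<Phi> (p i) (q i) = \<Psi> i / i ^ n" for \<Phi> \<Psi> and n :: nat
  proof -
    have "\<forall>\<^sub>F i in at 0. \<Psi> i \<noteq> 0"
      using cont by (simp add: isCont_def tendsto_imp_eventually_ne)
    moreover have "\<forall>\<^sub>F i in at 0. G i > 0"
      using cG unfolding isCont_def by (rule order_tendstoD) (simp add: G_def)
    ultimately have "\<forall>\<^sub>F i in at_right 0. \<Psi> i \<noteq> 0 \<and> G i > 0 \<and> i > 0"
      by (auto simp: eventually_at_split eventually_conj_iff eventually_at_right_less)
    then obtain i where i: "\<Psi> i \<noteq> 0" "G i > 0" "i > 0"
      using eventually_happens' trivial_limit_at_right_real by blast
    have "q i ^ 2 = poly (cubic a b) (p i)"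
      using i unfolding q_def power_divide s_def cubic_def p_def
      by (simp add: G_def field_simps power_numeral_reduce)
    moreover have "\<Phi> (p i) (q i) \<noteq> 0"
      using eq[OF i(3)] i by simp
    moreover have "odd (degree (cubic a b))"
      by (simp add: cubic_def)
    ultimately show ?thesis
      unfolding Z_def using reg by (intro regular_on_finite_zeros)
  qed
  note reg = regular_on_intros
  have rA: "regular_on (cubic a b) (ptA a b c)"
    unfolding ptA_def[abs_def] ptV_def ptW_def by (intro reg)
  have rB: "regular_on (cubic a b) (ptB a b c d)"
    unfolding ptB_def[abs_def] ptV_def ptW_def ptR_def by (intro reg)
  have rN: "regular_on (cubic a b) (ptN a b c d)"
    unfolding ptN_def[abs_def] by (intro reg rA rB)
  have rM: "regular_on (cubic a b) (ptM a b c d)"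
    unfolding ptM_def[abs_def] ptR_def ptV_def by (intro reg rA rB)
  have rK: "regular_on (cubic a b) (ptK a b c d)"
    unfolding ptK_def[abs_def] by (intro reg rA rN)
  show "finite (Z (ptA a b c))"
    by (rule zeros[OF rA cA _ A]) (simp add: A0)
  show "finite (Z (ptK a b c d))"
    by (rule zeros[OF rK cK _ K]) (simp add: K0)
  \<comment> \<open>Pole order 10 of \<open>N\<close> against 8 of \<open>A\<close>: the base
    coordinate \<open>N / A\<close> takes each value finitely often.\<close>
  show "finite (Z (\<lambda>u v. ptN a b c d u v - \<zeta> * ptA a b c u v))"
  proof (rule zeros)
    show "regular_on (cubic a b) (\<lambda>u v. ptN a b c d u v - \<zeta> * ptA a b c u v)"
      by (intro reg rN rA)
    show "isCont (\<lambda>i. N i - \<zeta> * A i * i ^ 2) 0"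
      by (intro continuous_intros cN cA)
    show "ptN a b c d (p i) (q i) - \<zeta> * ptA a b c (p i) (q i) = (N i - \<zeta> * A i * i ^ 2) / i ^ 10"
      if "i > 0" for i
      unfolding N[OF that] A[OF that] using that by (simp add: field_simps power_numeral_reduce)
  qed (simp add: N0)
  \<comment> \<open>Pole order 60 of \<open>M^3\<close> against 58 of \<open>A K\<close>; their
    quotient is \<open>y^3 / f(z)\<close>.\<close>
  show "finite (Z (\<lambda>u v. ptM a b c d u v ^ 3 - \<kappa> * (ptA a b c u v * ptK a b c d u v)))"
  proof (rule zeros)
    show "regular_on (cubic a b) (\<lambda>u v. ptM a b c d u v ^ 3 - \<kappa> * (ptA a b c u v * ptK a b c d u v))"
      by (intro reg rM rA rK)
    show "isCont (\<lambda>i. M i ^ 3 - \<kappa> * (A i * K i) * i ^ 2) 0"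
      by (intro continuous_intros cM cA cK)
    show "ptM a b c d (p i) (q i) ^ 3 - \<kappa> * (ptA a b c (p i) (q i) * ptK a b c d (p i) (q i)) =
        (M i ^ 3 - \<kappa> * (A i * K i) * i ^ 2) / i ^ 60"
      if "i > 0" for i
    proof -
      have i60: "i ^ 60 = i ^ 8 * i ^ 50 * i ^ 2" "i ^ 60 = (i ^ 20) ^ 3"
        by (simp_all flip: power_add power_mult)
      have "M i ^ 3 / i ^ 60 = (M i / i ^ 20) ^ 3"
        unfolding i60(2) by (rule power_divide[symmetric])
      moreover have "\<kappa> * (A i * K i) * i ^ 2 / i ^ 60 = \<kappa> * (A i / i ^ 8 * (K i / i ^ 50))"
        unfolding i60(1) times_divide_times_eq unfolding times_divide_eq_right
        by (rule mult_divide_mult_cancel_right) (use that in simp)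
      ultimately show ?thesis
        unfolding A[OF that] M[OF that] K[OF that] diff_divide_distrib by (simp only:)
    qed
  qed (simp add: M0)
qed

lemma curve_case:
  assumes f: "f = [:d, c, b, a, 0, 1:]" and inf: "infinite (E_points a b)"
  shows "zariski_dense_in (rational_points (surface f)) (surface f)"
proof (rule infinite_fibres_dense)
  define a' b' c' d' :: rat
    where "a' = of_int a" and "b' = of_int b" and "c' = of_int c" and "d' = of_int d"
  define ar br cr dr :: real
    where "ar = of_rat a'" and "br = of_rat b'" and "cr = of_rat c'" and "dr = of_rat d'"
  define Z where "Z = {z::rat. infinite {y::rat. \<exists>x. x ^ 2 = y ^ 3 + poly (map_poly of_int f) z}}"
  have fz: "poly (map_poly of_int f) z = z ^ 5 + a' * z ^ 3 + b' * z ^ 2 + c' * z + d'" for z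
    by (simp add: f a'_def b'_def c'_def d'_def map_poly_pCons power_numeral_reduce algebra_simps)
  define P where "P = {(u, v). v ^ 2 = poly (cubic a' b') u}"
  \<comment> \<open>Inverting the change of coordinates turns infinitely many points of the
    auxiliary curve into infinitely many rational pairs \<open>(u, v)\<close>.\<close>
  have "E_points a b - {Infinity} \<subseteq> (\<lambda>(u, v). Affine (30 - 30 * u) (30 * v)) ` P"
  proof
    fix Q assume Q: "Q \<in> E_points a b - {Infinity}"
    then obtain X Y where XY: "Q = Affine X Y"
      by (cases Q) auto
    with Q have "Y ^ 2 = X ^ 3 + (135 * (2 * a' - 15)) * X - 1350 * (5 * a' + 2 * b' - 26)"
      by (simp add: E_points_def a'_def b'_def)
    then have "(1 - X / 30, Y / 30) \<in> P"
      by (simp add: P_def cubic_def power_divide field_simps power_numeral_reduce)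
    then show "Q \<in> (\<lambda>(u, v). Affine (30 - 30 * u) (30 * v)) ` P"
      by (rule rev_image_eqI) (simp add: XY)
  qed
  moreover have "infinite (E_points a b - {Infinity})"
    using inf by simp
  ultimately have "infinite P"
    using finite_surj by blast
  define real_pt where "real_pt = (\<lambda>(u, v). (of_rat u :: real, of_rat v :: real))"
  have "inj_on real_pt P"
    by (auto simp: inj_on_def real_pt_def)
  then have "infinite (real_pt ` P)"
    using \<open>infinite P\<close> by (simp add: finite_image_iff)
  define zeros where "zeros \<Phi> = {(u, v). v ^ 2 = poly (cubic ar br) u \<and> \<Phi> u v = (0 :: real)}" for \<Phi>
  define C where "C = {0, - 1, 8, - 4 :: rat}"
  note fin = finite_zeros_from_infinity[of ar br, folded zeros_def]
  have "infinite Z"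
  proof
    assume "finite Z"
    moreover have "finite C"
      by (simp add: C_def)
    \<comment> \<open>Outside \<open>bad\<close> the constructed point exists, lies over some
      \<open>z\<close> not in \<open>Z\<close>, and avoids the torsion values; its fibre is then
      infinite, which puts \<open>z\<close> into \<open>Z\<close> after all.\<close>
    moreover define bad where "bad = zeros (ptA ar br cr) \<union> zeros (ptK ar br cr dr) \<union>
        (\<Union>z\<in>Z. zeros (\<lambda>u v. ptN ar br cr dr u v - of_rat z * ptA ar br cr u v)) \<union>
        (\<Union>k\<in>C. zeros (\<lambda>u v. ptM ar br cr dr u v ^ 3 - of_rat k * (ptA ar br cr u v * ptK ar br cr dr u v)))"
    ultimately have "finite bad"
      unfolding bad_def by (intro finite_UnI finite_UN_I fin)
    then obtain u v where "(u, v) \<in> P" and good: "(of_rat u, of_rat v) \<notin> bad"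
      using \<open>infinite (real_pt ` P)\<close> finite_subset[of "real_pt ` P" bad] by (force simp: real_pt_def)
    then have uv: "v ^ 2 = poly (cubic a' b') u"
      by (simp add: P_def)
    have curve: "(of_rat v) ^ 2 = poly (cubic ar br) (of_rat u)"
      unfolding ar_def br_def of_rat_cubic[symmetric] uv[symmetric] by (rule of_rat_power[symmetric])
    define A where "A = ptA a' b' c' u v"
    define N where "N = ptN a' b' c' d' u v"
    define M where "M = ptM a' b' c' d' u v"
    define K where "K = ptK a' b' c' d' u v"
    have r: "ptA ar br cr (of_rat u) (of_rat v) = of_rat A"
        "ptN ar br cr dr (of_rat u) (of_rat v) = of_rat N"
        "ptM ar br cr dr (of_rat u) (of_rat v) = of_rat M"
        "ptK ar br cr dr (of_rat u) (of_rat v) = of_rat K"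
      unfolding A_def N_def M_def K_def ar_def br_def cr_def dr_def
      by (simp_all add: of_rat_ptA of_rat_ptN of_rat_ptM of_rat_ptK)
    have "(of_rat A :: real) \<noteq> 0" "(of_rat K :: real) \<noteq> 0"
        "\<And>z. z \<in> Z \<Longrightarrow> (of_rat N - of_rat z * of_rat A :: real) \<noteq> 0"
        "\<And>k. k \<in> C \<Longrightarrow> (of_rat M ^ 3 - of_rat k * (of_rat A * of_rat K) :: real) \<noteq> 0"
      using good curve unfolding bad_def zeros_def r[symmetric] by auto
    then have nz: "A \<noteq> 0" "K \<noteq> 0" "\<And>z. z \<in> Z \<Longrightarrow> N \<noteq> z * A"
        "\<And>k. k \<in> C \<Longrightarrow> M ^ 3 \<noteq> k * (A * K)"
      by (auto simp flip: of_rat_mult of_rat_power)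
    define z where "z = N / A"
    define y where "y = M / A ^ 2"
    have pt: "\<exists>x. x ^ 2 = y ^ 3 + poly (map_poly of_int f) z" "poly (map_poly of_int f) z = K / A ^ 5"
      using point_from_curve[OF uv, of c' d'] nz(1)
      by (simp_all add: fz z_def y_def A_def N_def M_def K_def)
    have "y ^ 3 \<noteq> k * (K / A ^ 5)" if "k \<in> C" for k
    proof
      assume "y ^ 3 = k * (K / A ^ 5)"
      then have "A ^ 6 * y ^ 3 = k * (A * K)"
        using nz(1) by (simp add: field_simps power_numeral_reduce)
      then show False
        using nz(1) nz(4)[OF that] by (simp add: y_def power_divide flip: power_mult)
    qed
    then have "\<forall>k\<in>C. y ^ 3 \<noteq> k * (K / A ^ 5)"
      by blast
    moreover have "K / A ^ 5 \<noteq> 0"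
      using nz(1,2) by simp
    moreover obtain x where "x ^ 2 = y ^ 3 + K / A ^ 5"
      using pt unfolding pt(2) by blast
    ultimately have "infinite {y. \<exists>x. x ^ 2 = y ^ 3 + K / A ^ 5}"
      unfolding C_def by (intro infinite_fibre)
    then have "z \<in> Z"
      unfolding Z_def by (simp only: pt(2) mem_Collect_eq not_False_eq_True)
    then show False
      using nz(1) nz(3)[of z] by (simp add: z_def)
  qed
  then show "infinite {z::rat. infinite {y::rat. \<exists>x. x ^ 2 = y ^ 3 + poly (map_poly of_int f) z}}"
    unfolding Z_def .
qed

theorem theorem1:
  fixes a b c d :: int and f :: "int poly"
  assumes f: "f = [:d, c, b, a, 0, 1:]"
  shows "(has_multiple_root f \<longrightarrow>
            (\<exists>\<psi>. nonconstant \<psi> \<and> elliptic 0 (base_change f \<psi>) \<and> has_non_torsion_section f \<psi>) \<and>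
            zariski_dense_in (rational_points (surface f)) (surface f)) \<and>
         (\<not> has_multiple_root f \<and> infinite (E_points a b) \<longrightarrow>
            zariski_dense_in (rational_points (surface f)) (surface f))"
  using multiple_root_case[OF f] curve_case[OF f] by blast

end
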